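(* For $k\ge1$ let $P_0(k)$ be the proportion of integers $n\in[0,k^2+k)$ for which $N(n,k)=0$. Then $P_0(k)\to 3/\pi^2$ as $k\to\infty$.
   Context: For $n>k\ge1$, $N(n,k)$ is the nullity of the $n\times n$ skew-symmetric Toeplitz matrix $A(n,k)$ whose first $k$ superdiagonals have all entries $1$ and whose remaining superdiagonals have all entries $0$. This nullity depends only on $n\bmod (k^2+k)$, and $N(n,k)$ is defined for every integer $n$ as $N(n',k)$ for any $n'>k$ with $n'\equiv n\pmod{k^2+k}$. *)

theory Defs
  imports Complex_Main "Jordan_Normal_Form.Matrix_Kernel"
begin

definition A_mat :: "nat \<Rightarrow> nat \<Rightarrow> real mat" where
  "A_mat n k = mat n n (\<lambda>(i, j).
      if i < j \<and> j - i \<le> k then 1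
      else if j < i \<and> i - j \<le> k then -1
      else 0)"

text \<open>Nullity of A(n,k) (dimension of its kernel), meaningful for n > k.\<close>
definition nullity_A :: "nat \<Rightarrow> nat \<Rightarrow> nat" where
  "nullity_A n k = kernel_dim (A_mat n k)"

text \<open>N(n,k) for arbitrary integer n: nullity of A(n',k) for the representative
  n' = (n mod (k^2+k)) + (k^2+k) > k, which is congruent to n mod k^2+k.\<close>
definition N :: "int \<Rightarrow> nat \<Rightarrow> nat" where
  "N n k = nullity_A (nat (n mod int (k^2 + k)) + (k^2 + k)) k"

definition P0 :: "nat \<Rightarrow> real" where
  "P0 k = real (card {n \<in> {0..<k^2 + k}. N (int n) k = 0}) / real (k^2 + k)"

end

theory Submission
  imports Defs "HOL-Number_Theory.Totient" "HOL-Analysis.Gamma_Function"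
begin

text \<open>
  A vector \<open>X\<close> (extended by zero) lies in the kernel of \<open>A(n,k)\<close> iff its sums over the \<open>k\<close>
  positions after and the \<open>k\<close> positions before each \<open>i\<close> agree. Differencing this gives
  \<open>X i = S (i mod k) - S ((i - 1) mod (k + 1))\<close> for a function \<open>S\<close> on \<open>{0..k}\<close>, and \<open>X\<close> vanishes
  beyond \<open>n\<close> iff \<open>S\<close> is constant along the \<open>k\<close> edges joining \<open>i mod k\<close> to \<open>(i - 1) mod (k + 1)\<close>,
  \<open>n \<le> i < n + k\<close>. So the nullity is 0 iff these edges connect \<open>{0..k}\<close>, in which case they form
  a Hamiltonian path.

  Number the vertices along this path. In terms of these labels, passing from vertex \<open>i\<close> to
  vertex \<open>i + 1\<close> adds \<open>y\<close>, \<open>y - x\<close> or \<open>-x\<close>, exactly as in the three gap theorem, for coprime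
  \<open>x, y \<le> k\<close> with \<open>x + y > k\<close>; and every such pair (the denominators of two neighbouring Farey
  fractions of order \<open>k\<close>) arises from exactly one \<open>n\<close> modulo \<open>k\<^sup>2 + k\<close>. Hence the number of \<open>n\<close>
  with nullity 0 is \<open>\<phi>(1) + \<dots> + \<phi>(k)\<close>, which is asymptotic to \<open>3 k\<^sup>2 / \<pi>\<^sup>2\<close>.
\<close>

unbundle no vec_syntax

section \<open>Kernel vectors\<close>

text \<open>Gauss-Jordan elimination supplies a finite basis of the kernel. Dimension 0 means that
  this basis is empty, and an independent subset of \<open>{0\<^sub>v nc}\<close> is empty as
  well.\<close>

lemma kernel_dim_eq_0_iff:
  assumes A: "A \<in> carrier_mat nr nc"
  shows "kernel_dim A = 0 \<longleftrightarrow> mat_kernel A = {0\<^sub>v nc}"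
proof -
  interpret kernel nr nc A by unfold_locales (rule A)
  obtain P Q where P: "gauss_jordan_single A = P * A" "Q * P = 1\<^sub>m nr"
      "P \<in> carrier_mat nr nr" "Q \<in> carrier_mat nr nr"
    and B: "gauss_jordan_single A \<in> carrier_mat nr nc"
    and row: "row_echelon_form (gauss_jordan_single A)"
    using gauss_jordan_single[OF A refl] by auto
  \<comment> \<open>Row reduction multiplies by an invertible matrix from the left, so the kernel is
    unchanged.\<close>
  have eq: "mat_kernel (gauss_jordan_single A) = mat_kernel A"
    using mat_kernel_mult_eq[OF A P(3,4,2)] P(1) by simp
  obtain b where b: "finite b" "basis b"
    using find_base_vectors(3)[OF row B] unfolding eq by blast
  then have dim: "dim = card b" and span: "span b = mat_kernel A"
    and "b \<subseteq> mat_kernel A" "lin_indpt b"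
    using Ker.dim_basis Ker.basis_def by auto
  have "(1 :: 'a) \<in> UNIV - {0}" by simp
  then have "UNIV \<noteq> {0 :: 'a}" by blast
  with \<open>b \<subseteq> mat_kernel A\<close> \<open>lin_indpt b\<close> have "0\<^sub>v nc \<notin> b"
    using Ker.zero_nin_lin_indpt by simp
  show ?thesis
  proof
    assume "kernel_dim A = 0"
    then have "b = {}" using b dim kernel_dim by simp
    then show "mat_kernel A = {0\<^sub>v nc}" using span Ker.span_empty by simp
  next
    assume "mat_kernel A = {0\<^sub>v nc}"
    with \<open>b \<subseteq> mat_kernel A\<close> \<open>0\<^sub>v nc \<notin> b\<close> have "b = {}" by auto
    then show "kernel_dim A = 0" using dim kernel_dim by simp
  qed
qed

text \<open>Extending the vector by zero to all integers turns each row into a difference of two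
  full windows of length \<open>k\<close>, with no boundary cases.\<close>

lemma A_mat_mult_vec_nth:
  fixes X :: "int \<Rightarrow> real"
  assumes v: "v = Matrix.vec n (\<lambda>j. X (int j))" and X: "\<And>j. j \<notin> {0..<int n} \<Longrightarrow> X j = 0" and i: "i < n"
  shows "(A_mat n k *\<^sub>v v) $ i =
    sum X {int i + 1..int i + int k} - sum X {int i - int k..int i - 1}"
proof -
  have restrict: "(\<Sum>j\<in>{0..<int n}. if j \<in> I then X j else 0) = sum X I" if "finite I" for I
  proof -
    have "(\<Sum>j\<in>{0..<int n}. if j \<in> I then X j else 0) = sum X ({0..<int n} \<inter> I)"
      by (simp add: sum.inter_restrict)
    also have "\<dots> = sum X I"
      using that X by (intro sum.mono_neutral_left) blast+
    finally show ?thesis .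
  qed
  have "(A_mat n k *\<^sub>v v) $ i = (\<Sum>j\<in>{0..<n}.
      (if i < j \<and> j - i \<le> k then 1 else if j < i \<and> i - j \<le> k then - 1 else 0) * X (int j))"
    using i by (simp add: A_mat_def v scalar_prod_def)
  also have "\<dots> = (\<Sum>j\<in>{0..<n}. (if int j \<in> {int i + 1..int i + int k} then X (int j) else 0) -
      (if int j \<in> {int i - int k..int i - 1} then X (int j) else 0))"
    by (intro sum.cong) auto
  also have "\<dots> = (\<Sum>j\<in>{0..<int n}. (if j \<in> {int i + 1..int i + int k} then X j else 0) -
      (if j \<in> {int i - int k..int i - 1} then X j else 0))"
    by (rule sum.reindex_bij_witness[of _ nat int]) auto
  also have "\<dots> = sum X {int i + 1..int i + int k} - sum X {int i - int k..int i - 1}"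
    by (simp only: sum_subtractf restrict finite_atLeastAtMost_int)
  finally show ?thesis .
qed

lemma A_mat_kernel_trivial_iff:
  "mat_kernel (A_mat n k) = {0\<^sub>v n} \<longleftrightarrow>
    (\<forall>X :: int \<Rightarrow> real. (\<forall>j. j \<notin> {0..<int n} \<longrightarrow> X j = 0) \<longrightarrow>
      (\<forall>i\<in>{0..<int n}. sum X {i + 1..i + int k} = sum X {i - int k..i - 1}) \<longrightarrow> (\<forall>j. X j = 0))"
  (is "?L \<longleftrightarrow> ?R")
proof -
  have A: "A_mat n k \<in> carrier_mat n n" by (simp add: A_mat_def)
  show ?thesis
  proof
    assume L: ?L
    show ?R
    proof (intro allI impI)
      fix X :: "int \<Rightarrow> real" and j
      assume X: "\<forall>j. j \<notin> {0..<int n} \<longrightarrow> X j = 0"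
        and eq: "\<forall>i\<in>{0..<int n}. sum X {i + 1..i + int k} = sum X {i - int k..i - 1}"
      have "A_mat n k *\<^sub>v Matrix.vec n (\<lambda>j. X (int j)) = 0\<^sub>v n"
      proof (rule eq_vecI)
        show "(A_mat n k *\<^sub>v Matrix.vec n (\<lambda>j. X (int j))) $ i = 0\<^sub>v n $ i" if "i < dim_vec (0\<^sub>v n)" for i
          using that X eq by (subst A_mat_mult_vec_nth[OF refl]) auto
      qed (use A in simp)
      then have "Matrix.vec n (\<lambda>j. X (int j)) = 0\<^sub>v n"
        using L mat_kernelI[OF A] by auto
      then have "X (int i) = 0" if "i < n" for i
        using that by (metis index_vec index_zero_vec(1))
      then show "X j = 0"
        using X by (cases "j \<in> {0..<int n}") (auto dest: zero_le_imp_eq_int)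
    qed
  next
    assume R: ?R
    have "v = 0\<^sub>v n" if "v \<in> mat_kernel (A_mat n k)" for v
    proof -
      from mat_kernelD[OF A that] have v: "dim_vec v = n" "A_mat n k *\<^sub>v v = 0\<^sub>v n" by auto
      define X where "X j = (if j \<in> {0..<int n} then v $ nat j else 0)" for j
      have X_out: "X j = 0" if "j \<notin> {0..<int n}" for j using that by (auto simp: X_def)
      have vX: "v = Matrix.vec n (\<lambda>j. X (int j))" using v by (auto simp: X_def)
      have "sum X {i + 1..i + int k} = sum X {i - int k..i - 1}" if "i \<in> {0..<int n}" for i
      proof -
        from that obtain m where m: "i = int m" "m < n" by (auto dest: zero_le_imp_eq_int)
        have "(A_mat n k *\<^sub>v v) $ m = 0" using v m by simp
        then show ?thesis using A_mat_mult_vec_nth[OF vX X_out m(2), of k] m by simp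
      qed
      then have "X j = 0" for j using R X_out by blast
      then show ?thesis using vX by auto
    qed
    moreover have "0\<^sub>v n \<in> mat_kernel (A_mat n k)"
      using A by (intro mat_kernelI[OF A]) auto
    ultimately show ?L by blast
  qed
qed

section \<open>From balanced sequences to connectivity of a graph\<close>

text \<open>Connectivity of the graph on \<open>{0..k}\<close> with edges from
  \<open>i mod k\<close> to \<open>(i - 1) mod (k + 1)\<close>, expressed by functions: whatever is
  constant along the edges is constant. This is the form in which kernel vectors produce it.\<close>

definition links_connect :: "int \<Rightarrow> int \<Rightarrow> bool" where
  "links_connect k c \<longleftrightarrow> (\<forall>S :: int \<Rightarrow> real.
    (\<forall>i\<in>{c..<c + k}. S (i mod k) = S ((i - 1) mod (k + 1))) \<longrightarrow> (\<forall>j\<in>{0..k}. S j = S k))"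

lemma sum_mod_window:
  fixes f :: "int \<Rightarrow> 'a::comm_monoid_add"
  assumes "m > 0"
  shows "(\<Sum>j\<in>{a..<a + m}. f (j mod m)) = sum f {0..<m}"
proof (rule sum.reindex_bij_witness[of _ "\<lambda>r. a + (r - a) mod m" "\<lambda>j. j mod m"])
  fix j assume "j \<in> {a..<a + m}"
  then have "(j mod m - a) mod m = j - a"
    by (simp add: mod_diff_left_eq)
  then show "a + (j mod m - a) mod m = j" by simp
next
  fix r assume "r \<in> {0..<m}"
  then show "(a + (r - a) mod m) mod m = r"
    by (simp add: mod_add_right_eq)
qed (use assms in auto)

lemma sum_shift_interval:
  fixes f :: "int \<Rightarrow> 'a::ab_group_add"
  assumes "a \<le> b + 1"
  shows "sum f {a + 1..b + 1} = sum f {a..b} - f a + f (b + 1)"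
proof -
  have "sum f {a..b + 1} = f a + sum f {a + 1..b + 1}"
    using assms by (subst sum.remove[of _ a]) (auto intro!: arg_cong2[where f = sum])
  moreover have "sum f {a..b + 1} = f (b + 1) + sum f {a..b}"
    using assms by (subst sum.remove[of _ "b + 1"]) (auto intro!: arg_cong2[where f = sum])
  ultimately show ?thesis by (simp add: algebra_simps)
qed

text \<open>On \<open>-k \<le> i < 0\<close> the function \<open>S (i mod k) - S ((i - 1) mod (k + 1))\<close> vanishes for every
  \<open>S\<close>, which is why only the condition on \<open>{n..<n + k}\<close> appears in \<open>links_connect\<close>.\<close>

lemma balanced_trivial_iff_links_connect:
  fixes n k :: int
  assumes "k \<ge> 1" "n \<ge> k * (k + 1)"
  shows "(\<forall>X :: int \<Rightarrow> real. (\<forall>j. j \<notin> {0..<n} \<longrightarrow> X j = 0) \<longrightarrow>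
      (\<forall>i\<in>{0..<n}. sum X {i + 1..i + k} = sum X {i - k..i - 1}) \<longrightarrow> (\<forall>j. X j = 0))
    \<longleftrightarrow> links_connect k n" (is "?L \<longleftrightarrow> _")
proof -
  have "n > k" using assms mult_left_mono[of 2 "k + 1" k] by linarith
  show ?thesis
  proof
    assume L: ?L
    show "links_connect k n" unfolding links_connect_def
    proof (intro allI impI ballI)
      fix S :: "int \<Rightarrow> real" and j
      assume S: "\<forall>i\<in>{n..<n + k}. S (i mod k) = S ((i - 1) mod (k + 1))" and j: "j \<in> {0..k}"
      define g where "g i = S (i mod k) - S ((i - 1) mod (k + 1))" for i
      define X where "X i = (if i \<in> {0..<n} then g i else 0)" for i
      have "g i = 0" if "i \<in> {-k..<0}" for i
      proof -
        have "i mod k = i + k" "(i - 1) mod (k + 1) = i + k"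
          using that mod_pos_pos_trivial[of "i + k" k] mod_pos_pos_trivial[of "i + k" "k + 1"]
            mod_add_self2[of i k] mod_add_self2[of "i - 1" "k + 1"] by (auto simp: algebra_simps)
        then show ?thesis by (simp add: g_def)
      qed
      then have X_g: "X i = g i" if "i \<in> {-k..<n + k}" for i
        using that S by (auto simp: X_def g_def)
      have shift: "(\<Sum>j\<in>{a..b}. S ((j - 1) mod (k + 1))) = (\<Sum>j\<in>{a - 1..b - 1}. S (j mod (k + 1)))"
        for a b
        by (rule sum.reindex_bij_witness[of _ "\<lambda>j. j + 1" "\<lambda>j. j - 1"]) auto
      \<comment> \<open>A window of length \<open>k\<close> meets every residue modulo
        \<open>k\<close> once and misses one residue modulo \<open>k + 1\<close>. After the shift by
        one, the windows on both sides of \<open>i\<close> miss the same residue, that of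
        \<open>i - 1\<close>, so their sums agree.\<close>
      have up: "sum g {i + 1..i + k} = sum S {0..<k} - (sum S {0..<k + 1} - S ((i - 1) mod (k + 1)))" for i
      proof -
        have "{i - 1..<i - 1 + (k + 1)} = insert (i - 1) {i..i + k - 1}" using assms by auto
        moreover have "{i + 1..<i + 1 + k} = {i + 1..i + k}" by auto
        ultimately show ?thesis
          using sum_mod_window[of k S "i + 1"] sum_mod_window[of "k + 1" S "i - 1"] assms
          by (simp add: g_def sum_subtractf shift)
      qed
      have down: "sum g {i - k..i - 1} = sum S {0..<k} - (sum S {0..<k + 1} - S ((i - 1) mod (k + 1)))" for i
      proof -
        have "{i - k - 1..<i - k - 1 + (k + 1)} = insert (i - 1) {i - k - 1..i - 2}" using assms by auto
        moreover have "{i - k..<i - k + k} = {i - k..i - 1}" by auto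
        ultimately show ?thesis
          using sum_mod_window[of k S "i - k"] sum_mod_window[of "k + 1" S "i - k - 1"] assms
          by (simp add: g_def sum_subtractf shift)
      qed
      have "sum X {i + 1..i + k} = sum X {i - k..i - 1}" if "i \<in> {0..<n}" for i
      proof -
        have "sum X {i + 1..i + k} = sum g {i + 1..i + k}" "sum X {i - k..i - 1} = sum g {i - k..i - 1}"
          using that by (auto intro!: sum.cong X_g)
        then show ?thesis by (simp add: up down)
      qed
      moreover have "X i = 0" if "i \<notin> {0..<n}" for i using that by (auto simp: X_def)
      ultimately have X_0: "X i = 0" for i using L by blast
      show "S j = S k"
      proof (cases "j = k")
        case False
        with j have j: "j \<in> {0..<k}" by simp
        \<comment> \<open>The point \<open>j * (k + 1)\<close> has residue \<open>j\<close> modulo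
          \<open>k\<close>, and its predecessor has residue \<open>k\<close> modulo
          \<open>k + 1\<close>; there \<open>g\<close> equals \<open>S j - S k\<close>. The bound on
          \<open>n\<close> keeps the point inside the range where \<open>g\<close> agrees with
          \<open>X\<close>.\<close>
        have "j * (k + 1) \<le> (k - 1) * (k + 1)" using j by (intro mult_right_mono) auto
        also have "\<dots> < n" using assms by (simp add: algebra_simps)
        finally have "j * (k + 1) < n" .
        moreover have "0 \<le> j * (k + 1)" using j assms by (intro mult_nonneg_nonneg) auto
        ultimately have "j * (k + 1) \<in> {-k..<n + k}" using assms by auto
        then have "g (j * (k + 1)) = 0" using X_g X_0 by metis
        moreover have "j * (k + 1) mod k = j"
          using j by (simp add: distrib_left)
        moreover have "(j * (k + 1) - 1) mod (k + 1) = k"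
        proof -
          have "(j * (k + 1) - 1) mod (k + 1) = (k + (j - 1) * (k + 1)) mod (k + 1)"
            by (simp add: algebra_simps)
          also have "\<dots> = k" using assms by simp
          finally show ?thesis .
        qed
        ultimately show ?thesis by (simp add: g_def)
      qed simp
    qed
  next
    assume conn: "links_connect k n"
    show ?L
    proof (intro allI impI)
      fix X :: "int \<Rightarrow> real" and j
      assume X: "\<forall>j. j \<notin> {0..<n} \<longrightarrow> X j = 0"
        and eq: "\<forall>i\<in>{0..<n}. sum X {i + 1..i + k} = sum X {i - k..i - 1}"
      \<comment> \<open>Partial sums make \<open>g\<close> agree with \<open>X\<close> on
        \<open>{0..<k}\<close>; the value 0 at \<open>k\<close> serves as the empty sum, since
        \<open>(-1) mod (k + 1) = k\<close>.\<close>
      define S where "S r = (if r = k then 0 else sum X {0..r})" for r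
      define g where "g i = S (i mod k) - S ((i - 1) mod (k + 1))" for i
      \<comment> \<open>Subtracting the balance conditions at \<open>i\<close> and
        \<open>i + 1\<close> gives a recursion of order \<open>2 * k + 1\<close>. The function
        \<open>g\<close> satisfies it for every \<open>S\<close>, so agreement on
        \<open>{-k..k}\<close> propagates.\<close>
      have X_rec: "X (i + k + 1) = X (i + 1) + X i - X (i - k)" if "i \<in> {0..<n - 1}" for i
      proof -
        have "sum X {i + 1..i + k} = sum X {i - k..i - 1}" using eq that by auto
        moreover have "sum X {i + 1 + 1..i + k + 1} = sum X {i - k + 1..i - 1 + 1}"
          using eq[rule_format, of "i + 1"] that by (simp add: algebra_simps)
        ultimately show ?thesis
          using assms sum_shift_interval[of "i + 1" "i + k" X] sum_shift_interval[of "i - k" "i - 1" X]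
          by simp
      qed
      have g_rec: "g (i + k + 1) = g (i + 1) + g i - g (i - k)" for i
      proof -
        have "(i + k) mod (k + 1) = (i - 1) mod (k + 1)" "(i - k - 1) mod (k + 1) = i mod (k + 1)"
          "(i + k + 1) mod k = (i + 1) mod k" "(i - k) mod k = i mod k"
          using mod_add_self2[of "i - 1" "k + 1"] mod_diff_right_eq[of i "k + 1" "k + 1"]
            mod_add_self2[of "i + 1" k]
          by (simp_all add: algebra_simps)
        then show ?thesis by (simp add: g_def)
      qed
      have g_X: "g (int m - k) = X (int m - k)" if "int m < n + 2 * k" for m
        using that
      proof (induction m rule: less_induct)
        case (less m)
        define i where "i = int m - k"
        have i: "i \<ge> -k" "i < n + k" using less.prems by (auto simp: i_def)
        consider "i < 0" | "0 \<le> i" "i < k" | "i = k" | "i > k" by linarith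
        then have "g i = X i"
        proof cases
          case 1
          then have "i mod k = i + k" "(i - 1) mod (k + 1) = i + k"
            using i mod_pos_pos_trivial[of "i + k" k] mod_pos_pos_trivial[of "i + k" "k + 1"]
              mod_add_self2[of i k] mod_add_self2[of "i - 1" "k + 1"] by (auto simp: algebra_simps)
          with 1 X show ?thesis by (simp add: g_def)
        next
          case 2
          show ?thesis
          proof (cases "i = 0")
            case True
            have "(-1) mod (k + 1) = k"
              using mod_add_self2[of "-1" "k + 1"] assms by simp
            with True assms show ?thesis by (simp add: g_def S_def)
          next
            case False
            have "{0..i} = insert i {0..i - 1}" using 2 by auto
            then have "sum X {0..i} = sum X {0..i - 1} + X i" by simp
            with 2 False show ?thesis by (simp add: g_def S_def)
          qed
        next
          case 3
          \<comment> \<open>The last initial value comes from the balance at position 0, whose left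
            window lies outside the support.\<close>
          have "sum X {1..k} = sum X {- k..-1}"
            using eq[rule_format, of 0] assms \<open>n > k\<close> by simp
          also have "\<dots> = 0" using X by (intro sum.neutral) auto
          finally have "X 0 - sum X {0..k - 1} = X k"
            using sum_shift_interval[of 0 "k - 1" X] assms by simp
          then show ?thesis using 3 assms by (simp add: g_def S_def)
        next
          case 4
          define l where "l = i - k - 1"
          have l: "l \<ge> 0" "l < n - 1" using 4 i by (auto simp: l_def)
          have IH: "g j = X j" if "-k \<le> j" "j < i" for j
            using less.IH[of "nat (j + k)"] that less.prems by (auto simp: i_def nat_less_iff)
          have "g (l + k + 1) = X (l + k + 1)"
            unfolding g_rec using IH[of "l + 1"] IH[of l] IH[of "l - k"] X_rec[of l] l assms
            by (simp add: l_def)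
          then show ?thesis by (simp add: l_def)
        qed
        then show ?case by (simp add: i_def)
      qed
      have g_X: "g i = X i" if "i \<in> {-k..<n + k}" for i
        using g_X[of "nat (i + k)"] that by auto
      have "g i = 0" if "i \<in> {n..<n + k}" for i
        using g_X[of i] X that \<open>n > k\<close> assms by auto
      then have "\<forall>i\<in>{n..<n + k}. S (i mod k) = S ((i - 1) mod (k + 1))"
        by (auto simp: g_def)
      then have "S r = S k" if "r \<in> {0..k}" for r
        using conn that unfolding links_connect_def by blast
      then have S_0: "S r = 0" if "r \<in> {0..k}" for r
        using that by (simp add: S_def)
      have "i mod k \<in> {0..k}" "(i - 1) mod (k + 1) \<in> {0..k}" for i
        using assms pos_mod_bound[of k i] pos_mod_bound[of "k + 1" "i - 1"] by (auto intro: less_imp_le)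
      then have "g i = 0" for i using S_0 by (simp add: g_def)
      then show "X j = 0"
        using g_X[of j] X assms by (cases "j \<in> {0..<n}") auto
    qed
  qed
qed

lemma nullity_A_eq_0_iff:
  assumes "k \<ge> 1" "n \<ge> k * (k + 1)"
  shows "nullity_A n k = 0 \<longleftrightarrow> links_connect (int k) (int n)"
proof -
  have "A_mat n k \<in> carrier_mat n n" by (simp add: A_mat_def)
  moreover have "int k * (int k + 1) \<le> int n"
    using assms(2) by (metis of_nat_1 of_nat_add of_nat_le_iff of_nat_mult)
  moreover have "1 \<le> int k" using assms(1) by simp
  ultimately show ?thesis
    unfolding nullity_A_def
    by (simp only: kernel_dim_eq_0_iff A_mat_kernel_trivial_iff balanced_trivial_iff_links_connect)
qed

lemma links_connect_add_period:
  "links_connect k (c + k * (k + 1)) \<longleftrightarrow> links_connect k c"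
proof -
  have "(i + k * (k + 1)) mod k = i mod k" "(i + k * (k + 1) - 1) mod (k + 1) = (i - 1) mod (k + 1)" for i
    using mod_mult_self1[of "i - 1" k "k + 1"] mod_mult_self2[of i k "k + 1"]
    by (simp_all only: diff_add_eq)
  moreover have "{c + k * (k + 1)..<c + k * (k + 1) + k} = (\<lambda>i. i + k * (k + 1)) ` {c..<c + k}"
    by (simp add: image_add_atLeastLessThan' add_ac)
  ultimately show ?thesis
    unfolding links_connect_def
    by (simp del: image_add_atLeastLessThan image_add_atLeastLessThan')
qed

lemma N_eq_0_iff:
  assumes "k \<ge> 1" "n < k ^ 2 + k"
  shows "N (int n) k = 0 \<longleftrightarrow> links_connect (int k) (int n)"
proof -
  have K: "k ^ 2 + k = k * (k + 1)" by (simp add: power2_eq_square)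
  have "int n mod int (k ^ 2 + k) = int n"
    using assms(2) by (intro mod_pos_pos_trivial) (simp_all only: of_nat_less_iff of_nat_0_le_iff)
  then have "N (int n) k = nullity_A (n + k * (k + 1)) k"
    unfolding N_def by (simp add: K)
  moreover have "int (n + k * (k + 1)) = int n + int k * (int k + 1)"
    by (simp add: algebra_simps)
  ultimately show ?thesis
    using assms(1) by (simp only: nullity_A_eq_0_iff[OF assms(1) le_add2] links_connect_add_period)
qed

section \<open>Hamiltonian paths and the three gap step\<close>

text \<open>When \<open>x + y > k\<close>, the cases cut \<open>{0..k}\<close> into the intervals
  \<open>{0..k - y}\<close>, \<open>{k - y + 1..x - 1}\<close> and \<open>{x..k}\<close>, with
  displacements \<open>y\<close>, \<open>y - x\<close> and \<open>- x\<close>.\<close>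

definition gap_step :: "int \<Rightarrow> int \<Rightarrow> int \<Rightarrow> int \<Rightarrow> int" where
  "gap_step k x y j = (if j + y \<le> k then j + y else if x \<le> j then j - x else j + y - x)"

text \<open>\<open>L\<close> gives positions along the Hamiltonian path, oriented so that each edge
  raises the label by one. Vertex \<open>k\<close> is never of the form \<open>i mod k\<close>, so
  it is the end of the path.\<close>

definition link_labelling :: "int \<Rightarrow> int \<Rightarrow> (int \<Rightarrow> int) \<Rightarrow> bool" where
  "link_labelling k c L \<longleftrightarrow> bij_betw L {0..k} {0..k} \<and> L k = k \<and>
    (\<forall>i\<in>{c..<c + k}. L ((i - 1) mod (k + 1)) = L (i mod k) + 1)"

text \<open>The condition is cyclic: at \<open>i = k\<close> it fixes the label of vertex 0. For
  \<open>x\<close> and \<open>y\<close> in \<open>{1..k}\<close> it yields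
  \<open>x = k - L 0\<close> and \<open>y = k - L (k - 1)\<close>.\<close>

definition gap_labelling :: "int \<Rightarrow> int \<Rightarrow> int \<Rightarrow> (int \<Rightarrow> int) \<Rightarrow> bool" where
  "gap_labelling k x y L \<longleftrightarrow> bij_betw L {0..k} {0..k} \<and> L k = k \<and>
    (\<forall>i\<in>{0..k}. L ((i + 1) mod (k + 1)) = gap_step k x y (L i))"

definition farey_denominators :: "int \<Rightarrow> (int \<times> int) set" where
  "farey_denominators k = {(x, y). x \<in> {1..k} \<and> y \<in> {1..k} \<and> x + y > k \<and> coprime x y}"

section \<open>Single cycles and labelled Hamiltonian paths\<close>

text \<open>Applied to the orbit of \<open>k\<close>, transitivity shows that the orbit is all of
  \<open>{0..k}\<close>, and injectivity makes \<open>f\<close> one cycle of length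
  \<open>k + 1\<close>. The enumeration is \<open>P i = (f ^^ (i + 1)) k\<close>, shifted by one so
  that the cycle closes at \<open>P k = k\<close>.\<close>

lemma cyclic_enumeration:
  fixes k :: int
  assumes "k \<ge> 0" and closed: "f ` {0..k} \<subseteq> {0..k}" and inj: "inj_on f {0..k}"
    and transitive: "\<And>A. A \<subseteq> {0..k} \<Longrightarrow> k \<in> A \<Longrightarrow> f ` A \<subseteq> A \<Longrightarrow> A = {0..k}"
  obtains P where "bij_betw P {0..k} {0..k}" "P k = k"
    "\<And>i. i \<in> {0..k} \<Longrightarrow> P ((i + 1) mod (k + 1)) = f (P i)"
proof -
  define h where "h n = (f ^^ n) k" for n
  have h_0: "h 0 = k" and h_Suc: "h (Suc n) = f (h n)" for n by (auto simp: h_def)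
  have h_in: "h n \<in> {0..k}" for n
    using closed by (induction n) (auto simp: h_0 h_Suc image_subset_iff assms(1))
  have "f ` range h \<subseteq> range h" by (auto simp flip: h_Suc)
  then have range_h: "range h = {0..k}"
    using h_in h_0 by (intro transitive) (auto intro: rev_image_eqI[of 0])
  have cancel: "h n = k" if "h (m + n) = h m" for m n
    using that
  proof (induction m)
    case (Suc m)
    then have "h (m + n) = h m"
      using inj h_in by (auto simp: h_Suc dest: inj_onD)
    then show ?case by (rule Suc.IH)
  qed (simp add: h_0)
  \<comment> \<open>Before a positive return time \<open>n\<close> the orbit takes at most
    \<open>n\<close> values, yet it has \<open>k + 1\<close> points.\<close>
  have period: "int n > k" if "h n = k" "n > 0" for n
  proof -
    have "h m = h (m mod n)" for m
      using funpow_mod_eq[of n f k m] that by (simp add: h_def)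
    then have "range h \<subseteq> h ` {..<n}"
      using that(2) by (metis image_eqI image_subsetI lessThan_iff mod_less_divisor)
    then have "card {0..k} \<le> card {..<n}"
      unfolding range_h using card_mono[of "h ` {..<n}"] card_image_le[of "{..<n}" h]
      by (meson finite_imageI finite_lessThan le_trans)
    then show ?thesis using assms(1) by simp
  qed
  have inj_h: "a = b" if "h a = h b" "int a \<le> k" "int b \<le> k" for a b
    using that
  proof (induction a b rule: linorder_wlog)
    case (le a b)
    then show ?case
      using cancel[of a "b - a"] period[of "b - a"] by (cases "a = b") auto
  qed simp
  have inj_hn: "inj_on (\<lambda>i. h (nat i)) {0..k}"
    by (rule inj_onI) (use inj_h in \<open>fastforce simp: nat_eq_iff2\<close>)
  then have img: "(\<lambda>i. h (nat i)) ` {0..k} = {0..k}"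
    using h_in by (intro endo_inj_surj) auto
  define P where "P i = f (h (nat i))" for i
  have "P ` {0..k} = f ` {0..k}"
    using img by (metis (no_types, lifting) P_def image_cong image_image)
  also have "\<dots> = {0..k}"
    using inj closed by (intro endo_inj_surj) auto
  finally have P_img: "P ` {0..k} = {0..k}" .
  moreover from this have "inj_on P {0..k}"
    by (intro eq_card_imp_inj_on) auto
  ultimately have "bij_betw P {0..k} {0..k}" by (simp add: bij_betw_def)
  moreover have P_k: "P k = k"
  proof -
    \<comment> \<open>The iterate \<open>k + 1\<close> repeats some iterate
      \<open>a \<le> k\<close>. Cancelling gives the return time \<open>k + 1 - a\<close>, which
      exceeds \<open>k\<close> only for \<open>a = 0\<close>.\<close>
    have "h (nat k + 1) \<in> (\<lambda>i. h (nat i)) ` {0..k}" using img h_in by simp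
    then obtain a where a: "a \<in> {0..k}" "h (nat k + 1) = h (nat a)" by auto
    have "h (nat k + 1 - nat a) = k"
      using a cancel[of "nat a" "nat k + 1 - nat a"] by (simp add: nat_le_iff)
    then have "int (nat k + 1 - nat a) > k"
      using a by (intro period) auto
    then have "a = 0" using a(1) unfolding atLeastAtMost_iff by arith
    then show ?thesis using a(2) by (simp add: P_def h_0 flip: h_Suc)
  qed
  moreover have "P ((i + 1) mod (k + 1)) = f (P i)" if "i \<in> {0..k}" for i
  proof (cases "i = k")
    case True
    then show ?thesis using P_k by (simp add: P_def h_0)
  next
    case False
    with that have "(i + 1) mod (k + 1) = i + 1" "nat (i + 1) = Suc (nat i)" by auto
    then show ?thesis by (simp add: P_def h_Suc)
  qed
  ultimately show thesis using that by blast
qed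

lemma link_labellingD:
  assumes "link_labelling k c L"
  shows "inj_on L {0..k}" "L ` {0..k} = {0..k}" "L k = k"
    "i \<in> {0..k} \<Longrightarrow> 0 \<le> L i \<and> L i \<le> k"
    "i \<in> {c..<c + k} \<Longrightarrow> L ((i - 1) mod (k + 1)) = L (i mod k) + 1"
  using assms unfolding link_labelling_def bij_betw_def by auto

lemma gap_labellingD:
  assumes "gap_labelling k x y L"
  shows "inj_on L {0..k}" "L ` {0..k} = {0..k}" "L k = k"
    "i \<in> {0..k} \<Longrightarrow> 0 \<le> L i \<and> L i \<le> k"
    "i \<in> {0..k} \<Longrightarrow> L ((i + 1) mod (k + 1)) = gap_step k x y (L i)"
  using assms unfolding gap_labelling_def bij_betw_def by auto

lemma ex_link_of_residue:
  fixes u c k :: int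
  assumes "u \<in> {0..<k}"
  obtains i where "i \<in> {c..<c + k}" "i mod k = u"
proof
  show "c + (u - c) mod k \<in> {c..<c + k}" using assms by auto
  show "(c + (u - c) mod k) mod k = u" using assms by (simp add: mod_add_right_eq)
qed

text \<open>Following edges in the direction of growing labels leads from any vertex to
  \<open>k\<close>; the induction is on the distance \<open>k - L u\<close>.\<close>

lemma links_connect_if_link_labelling:
  assumes "k \<ge> 1" and L: "link_labelling k c L"
  shows "links_connect k c"
  unfolding links_connect_def
proof (intro allI impI ballI)
  fix S :: "int \<Rightarrow> real" and u
  assume S: "\<forall>i\<in>{c..<c + k}. S (i mod k) = S ((i - 1) mod (k + 1))" and "u \<in> {0..k}"
  note LD = link_labellingD[OF L]
  have "S u = S k" if "u \<in> {0..k}" "L u = k - int n" for u n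
    using that
  proof (induction n arbitrary: u)
    case 0
    then have "u = k" using LD(1,3) assms(1) by (auto dest: inj_onD)
    then show ?case by simp
  next
    case (Suc n)
    then have "u \<noteq> k" using LD(3) by auto
    with Suc.prems obtain i where i: "i \<in> {c..<c + k}" "i mod k = u"
      using ex_link_of_residue[of u k c] by auto
    have "(i - 1) mod (k + 1) \<in> {0..k}"
      using assms(1) pos_mod_bound[of "k + 1" "i - 1"] by auto
    moreover have "L ((i - 1) mod (k + 1)) = k - int n"
      using LD(5)[OF i(1)] i(2) Suc.prems by simp
    ultimately have "S ((i - 1) mod (k + 1)) = S k" by (rule Suc.IH)
    then show ?case using S i by auto
  qed
  from this[of u "nat (k - L u)"] show "S u = S k"
    using \<open>u \<in> {0..k}\<close> LD(4)[of u] by simp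
qed

text \<open>The edges define a partial injection from \<open>i mod k\<close> to
  \<open>(i - 1) mod (k + 1)\<close>. Closing it up at \<open>k\<close> gives a permutation
  \<open>f\<close>; connectivity makes \<open>f\<close> a single cycle, and \<open>L\<close> is the
  inverse of its enumeration.\<close>

lemma ex_link_labelling_if_links_connect:
  assumes "k \<ge> 1" "links_connect k c"
  obtains L where "link_labelling k c L"
proof -
  \<comment> \<open>The offset of the edge leaving \<open>u\<close>. The choice
    \<open>t k = k\<close> sends \<open>k\<close> to the residue of \<open>c - 2\<close>, the only
    vertex that no edge enters.\<close>
  define t where "t u = (if u = k then k else (u - c) mod k)" for u
  define f where "f u = (c - 1 + t u) mod (k + 1)" for u
  have t_in: "t u \<in> {0..k}" for u
    using assms(1) pos_mod_bound[of k "u - c"] by (auto simp: t_def intro: less_imp_le)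
  have f_in: "f u \<in> {0..k}" for u
    using assms(1) pos_mod_bound[of "k + 1" "c - 1 + t u"] by (auto simp: f_def)
  have f_link: "f (i mod k) = (i - 1) mod (k + 1)" if "i \<in> {c..<c + k}" for i
  proof -
    have "(i mod k - c) mod k = i - c" using that by (simp add: mod_diff_left_eq)
    moreover have "i mod k \<noteq> k" using assms(1) pos_mod_bound[of k i] by linarith
    ultimately show ?thesis by (simp add: f_def t_def)
  qed
  have inj: "inj_on f {0..k}"
  proof (rule inj_onI)
    fix u v assume uv: "u \<in> {0..k}" "v \<in> {0..k}" "f u = f v"
    have "t u mod (k + 1) = t v mod (k + 1)"
      using uv(3) unfolding f_def by (metis add_diff_cancel_left' mod_diff_left_eq)
    then have t: "t u = t v"
      using t_in[of u] t_in[of v] by simp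
    show "u = v"
    proof (cases "u = k \<or> v = k")
      case True
      moreover have "(u - c) mod k < k" "(v - c) mod k < k"
        using assms(1) pos_mod_bound[of k] by force+
      ultimately show ?thesis using t unfolding t_def by (metis less_irrefl)
    next
      case False
      then have "(u - c) mod k = (v - c) mod k" using t by (simp add: t_def)
      then have "u mod k = v mod k" by (metis diff_add_cancel mod_add_left_eq)
      then show ?thesis using False uv by simp
    qed
  qed
  have trans: "A = {0..k}" if A: "A \<subseteq> {0..k}" "k \<in> A" "f ` A \<subseteq> A" for A
  proof -
    have "f ` A = A"
      using A(3) finite_subset[OF A(1)] inj_on_subset[OF inj A(1)] by (intro endo_inj_surj) simp_all
    then have iff: "f u \<in> A \<longleftrightarrow> u \<in> A" if "u \<in> {0..k}" for u
      using inj_on_image_mem_iff[OF inj that A(1)] by simp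
    \<comment> \<open>Since \<open>f\<close> permutes \<open>A\<close>, the indicator function of
      \<open>A\<close> is constant along the edges and can be used as \<open>S\<close> in
      \<open>links_connect\<close>.\<close>
    have "indicator A (i mod k) = (indicator A ((i - 1) mod (k + 1)) :: real)"
      if "i \<in> {c..<c + k}" for i
    proof -
      have "i mod k \<in> {0..k}" using assms(1) by (auto intro: less_imp_le)
      then show ?thesis using iff[of "i mod k"] f_link[OF that] by (simp add: indicator_def)
    qed
    then have "indicator A j = (indicator A k :: real)" if "j \<in> {0..k}" for j
      using assms(2) that unfolding links_connect_def by blast
    then show ?thesis using A by (auto simp: indicator_def split: if_splits)
  qed
  obtain P where P: "bij_betw P {0..k} {0..k}" "P k = k"
    "\<And>j. j \<in> {0..k} \<Longrightarrow> P ((j + 1) mod (k + 1)) = f (P j)"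
    by (rule cyclic_enumeration[of k f]) (use assms(1) f_in inj trans in auto)
  define L where "L = inv_into {0..k} P"
  have LP: "L (P j) = j" if "j \<in> {0..k}" for j
    using that P(1) by (auto simp: L_def bij_betw_def)
  have "bij_betw L {0..k} {0..k}"
    unfolding L_def by (rule bij_betw_inv_into[OF P(1)])
  moreover have "L k = k" using LP[of k] P(2) assms(1) by simp
  moreover have "L ((i - 1) mod (k + 1)) = L (i mod k) + 1" if "i \<in> {c..<c + k}" for i
  proof -
    have "i mod k \<in> {0..<k}" using assms(1) by simp
    moreover have "P ` {0..k} = {0..k}" using P(1) by (simp add: bij_betw_def)
    ultimately have "i mod k \<in> P ` {0..k}" by simp
    then obtain j where j: "j \<in> {0..k}" "i mod k = P j" by blast
    with \<open>i mod k \<in> {0..<k}\<close> P(2) have "j \<noteq> k" by auto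
    with j have "P (j + 1) = (i - 1) mod (k + 1)"
      using P(3)[of j] f_link[OF that] by simp
    then show ?thesis
      using LP[of j] LP[of "j + 1"] j \<open>j \<noteq> k\<close> by auto
  qed
  ultimately show thesis by (intro that[of L]) (simp add: link_labelling_def)
qed

section \<open>From Hamiltonian paths to the three gap step\<close>

lemma mod_Suc_int:
  fixes a m :: int
  assumes "m > 0"
  shows "(a + 1) mod m = (if a mod m = m - 1 then 0 else a mod m + 1)"
proof (cases "a mod m = m - 1")
  case True
  then show ?thesis using mod_add_left_eq[of a m 1] by simp
next
  case False
  then have "(a mod m + 1) mod m = a mod m + 1"
    using assms pos_mod_bound[of m a] pos_mod_sign[of m a] by (intro mod_pos_pos_trivial) linarith+
  then show ?thesis using False mod_add_left_eq[of a m 1] by simp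
qed

lemma int_interval_constant:
  fixes D :: "int \<Rightarrow> 'a"
  assumes "\<And>j. a \<le> j \<Longrightarrow> j < b \<Longrightarrow> D (j + 1) = D j" "a \<le> j" "j \<le> b"
  shows "D j = D a"
  using assms(2,3) by (induction j rule: int_ge_induct) (use assms(1) in auto)

text \<open>The vertex \<open>(c + t - 1) mod (k + 1)\<close> with \<open>0 \<le> t < k\<close> is
  entered by an edge and so has a positive label. Only \<open>t = k\<close> is left for the label
  0.\<close>

lemma link_labelling_0:
  assumes "k \<ge> 1" and L: "link_labelling k c L"
  shows "L ((c - 2) mod (k + 1)) = 0"
proof -
  note LD = link_labellingD[OF L]
  have "0 \<in> L ` {0..k}" using LD(2) assms(1) by simp
  then obtain v where v: "v \<in> {0..k}" "L v = 0" by auto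
  define t where "t = (v - c + 1) mod (k + 1)"
  have t: "0 \<le> t" "t \<le> k"
    using assms(1) pos_mod_bound[of "k + 1" "v - c + 1"] by (auto simp: t_def)
  have v_t: "(c + t - 1) mod (k + 1) = v"
  proof -
    have "(c + t - 1) mod (k + 1) = (c - 1 + t) mod (k + 1)" by (simp add: algebra_simps)
    also have "\<dots> = (c - 1 + (v - c + 1)) mod (k + 1)"
      unfolding t_def by (rule mod_add_right_eq)
    also have "\<dots> = v" using v by simp
    finally show ?thesis .
  qed
  have "t = k"
  proof (rule ccontr)
    assume "t \<noteq> k"
    with t have "L v = L ((c + t) mod k) + 1" using LD(5)[of "c + t"] v_t by simp
    moreover have "(c + t) mod k \<in> {0..k}"
      using assms(1) pos_mod_bound[of k "c + t"] by (auto intro: less_imp_le)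
    ultimately show False using LD(4)[of "(c + t) mod k"] v by simp
  qed
  then have "v = (c - 2 + (k + 1)) mod (k + 1)" using v_t by (simp add: algebra_simps)
  also have "\<dots> = (c - 2) mod (k + 1)" by (rule mod_add_self2)
  finally show ?thesis using v by simp
qed

text \<open>Let \<open>D j\<close> be the change of label from the vertex labelled \<open>j\<close>
  to the cyclically next vertex. Comparing consecutive edges shows that \<open>D\<close> is constant
  apart from two breakpoints, which gives the three cases of \<open>gap_step\<close>.\<close>

lemma gap_labelling_if_link_labelling:
  assumes "k \<ge> 1" and L: "link_labelling k c L"
  defines "x \<equiv> k - L 0" and "y \<equiv> k - L (k - 1)"
  shows "gap_labelling k x y L" and "x \<in> {1..k}" "y \<in> {1..k}" "x + y > k"
proof -
  note LD = link_labellingD[OF L]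
  define P where "P = inv_into {0..k} L"
  have P: "P j \<in> {0..k}" "L (P j) = j" if "j \<in> {0..k}" for j
    using that inv_into_into[of j L "{0..k}"] f_inv_into_f[of j L "{0..k}"]
    unfolding P_def LD(2) by blast+
  have PL: "P (L i) = i" if "i \<in> {0..k}" for i
    using that LD(1) by (simp add: P_def)
  define D where "D j = L ((P j + 1) mod (k + 1)) - j" for j
  \<comment> \<open>The vertex where the last edge, \<open>i = c + k - 1\<close>, starts. Its label
    \<open>m\<close> is a breakpoint because there is no following edge to compare with.\<close>
  define r where "r = (c - 1) mod k"
  define m where "m = L r"
  have r: "r \<in> {0..<k}" using assms(1) by (simp add: r_def)
  have L_neq_k: "L i < k" if "i \<in> {0..<k}" for i
    using that LD(4)[of i] LD(1,3) by (force dest: inj_onD[of L _ i k])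
  have m: "0 \<le> m" "m < k" using L_neq_k[OF r] LD(4)[of r] r by (auto simp: m_def)
  show x: "x \<in> {1..k}" and y: "y \<in> {1..k}"
    using assms(1) L_neq_k[of 0] L_neq_k[of "k - 1"] LD(4)[of 0] LD(4)[of "k - 1"]
    by (auto simp: x_def y_def)
  have D_k: "D k = - x" using PL[of k] LD(3) assms(1) by (simp add: D_def x_def)
  have D_y: "D (k - y) = y" using PL[of "k - 1"] LD(3) assms(1) by (simp add: D_def y_def)
  \<comment> \<open>The last edge ends at the residue of \<open>c + k - 2\<close>, whose successor
    modulo \<open>k + 1\<close> is that of \<open>c - 2\<close>, the vertex labelled 0.\<close>
  have D_m: "D (m + 1) = - (m + 1)"
  proof -
    have "(c + k - 1) mod k = r"
      using mod_add_self2[of "c - 1" k] by (simp add: r_def algebra_simps)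
    then have v: "L ((c + k - 2) mod (k + 1)) = m + 1"
      using LD(5)[of "c + k - 1"] assms(1) by (simp add: m_def)
    have "(c + k - 2) mod (k + 1) \<in> {0..k}"
      using assms(1) pos_mod_bound[of "k + 1" "c + k - 2"] by auto
    then have "P (m + 1) = (c + k - 2) mod (k + 1)" using PL v by force
    then have "(P (m + 1) + 1) mod (k + 1) = (c + k - 2 + 1) mod (k + 1)"
      by (simp only: mod_add_left_eq)
    also have "\<dots> = (c - 2 + (k + 1)) mod (k + 1)" by (simp add: algebra_simps)
    also have "\<dots> = (c - 2) mod (k + 1)" by (rule mod_add_self2)
    finally show ?thesis
      using link_labelling_0[OF assms(1) L] by (simp add: D_def)
  qed
  \<comment> \<open>Edge \<open>i\<close> joins labels \<open>j\<close> and \<open>j + 1\<close>,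
    and edge \<open>i + 1\<close> joins the successors of its two ends. The increments agree unless
    \<open>i + 1\<close> wraps around modulo \<open>k\<close>, which happens at vertex
    \<open>k - 1\<close> with label \<open>k - y\<close>.\<close>
  have D_step: "D (j + 1) = (if j = k - y then y - x else D j)"
    if j: "0 \<le> j" "j < k" "j \<noteq> m" for j
  proof -
    have "P j \<noteq> k" using P(2)[of j] j LD(3) by auto
    with P(1)[of j] j obtain i where i: "i \<in> {c..<c + k}" "i mod k = P j"
      using ex_link_of_residue[of "P j" k c] by auto
    have "i \<noteq> c + k - 1"
    proof
      assume "i = c + k - 1"
      then have "i = c - 1 + k" by simp
      then have "P j = r" using i(2) by (simp add: r_def)
      then show False using P(2)[of j] j by (simp add: m_def)
    qed
    with i have next_link: "L (i mod (k + 1)) = L ((i + 1) mod k) + 1"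
      using LD(5)[of "i + 1"] by simp
    have v: "L ((i - 1) mod (k + 1)) = j + 1"
      using LD(5)[OF i(1)] i(2) P(2)[of j] j by simp
    have "(i - 1) mod (k + 1) \<in> {0..k}"
      using assms(1) pos_mod_bound[of "k + 1" "i - 1"] by auto
    then have "P (j + 1) = (i - 1) mod (k + 1)" using PL v by force
    then have "D (j + 1) = L (i mod (k + 1)) - (j + 1)"
      by (simp add: D_def mod_add_left_eq)
    also have "\<dots> = L ((i + 1) mod k) - j" using next_link by simp
    also have "\<dots> = (if P j = k - 1 then L 0 - j else L (P j + 1) - j)"
      using assms(1) mod_Suc_int[of k i] i(2) by simp
    also have "\<dots> = (if j = k - y then y - x else D j)"
    proof -
      have "P j = k - 1 \<longleftrightarrow> j = k - y"
        using P[of j] PL[of "k - 1"] j assms(1) by (auto simp: y_def)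
      moreover have "(P j + 1) mod (k + 1) = P j + 1"
        using P(1)[of j] \<open>P j \<noteq> k\<close> j by auto
      ultimately show ?thesis by (auto simp: D_def x_def)
    qed
    finally show ?thesis .
  qed
  have D_const: "D (j + 1) = D j" if "0 \<le> j" "j < k" "j \<noteq> m" "j \<noteq> k - y" for j
    using D_step[of j] that by simp
  \<comment> \<open>Otherwise \<open>D\<close> would be constant from \<open>m + 1\<close> to
    \<open>k - y\<close>, although it is negative at the first and positive at the second.\<close>
  have "k - y \<le> m"
  proof (rule ccontr)
    assume less: "\<not> k - y \<le> m"
    have "D (k - y) = D (m + 1)"
      by (rule int_interval_constant[where b = "k - y"], rule D_const) (use less m y in auto)
    with D_m D_y m y show False by auto
  qed
  have D_left: "D j = y" if "0 \<le> j" "j \<le> k - y" for j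
  proof -
    have const: "D j = D 0" if "0 \<le> j" "j \<le> k - y" for j
      by (rule int_interval_constant[where b = "k - y"], rule D_const)
         (use that m \<open>k - y \<le> m\<close> y in auto)
    show ?thesis using const[of j] const[of "k - y"] that y D_y by simp
  qed
  have D_right: "D j = - x" if "m < j" "j \<le> k" for j
  proof -
    have const: "D j = D (m + 1)" if "m < j" "j \<le> k" for j
      by (rule int_interval_constant[where b = k], rule D_const)
         (use that m \<open>k - y \<le> m\<close> y in auto)
    show ?thesis using const[of j] const[of k] that m D_k by simp
  qed
  \<comment> \<open>\<open>D\<close> is constant on \<open>{m + 1..k}\<close>, with value
    \<open>- (m + 1)\<close> at one end and \<open>- x\<close> at the other.\<close>
  have x_m: "x = m + 1" using D_m D_right[of "m + 1"] m by simp
  have D_mid: "D j = y - x" if "k - y < j" "j \<le> m" for j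
  proof -
    have "D j = D (k - y + 1)"
      by (rule int_interval_constant[where b = m], rule D_const) (use that m y in auto)
    also have "\<dots> = y - x" using D_step[of "k - y"] that m y by auto
    finally show ?thesis .
  qed
  show "x + y > k" using x_m \<open>k - y \<le> m\<close> by simp
  have "L ((i + 1) mod (k + 1)) = gap_step k x y (L i)" if i: "i \<in> {0..k}" for i
  proof -
    have "L ((i + 1) mod (k + 1)) = L i + D (L i)" using PL[OF i] by (simp add: D_def)
    also have "\<dots> = gap_step k x y (L i)"
      using D_left[of "L i"] D_mid[of "L i"] D_right[of "L i"] LD(4)[OF i] x_m
      by (auto simp: gap_step_def)
    finally show ?thesis .
  qed
  then show "gap_labelling k x y L"
    using L by (auto simp: gap_labelling_def link_labelling_def)
qed

text \<open>Every displacement is a multiple of \<open>gcd x y\<close>, so all labels are congruent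
  to \<open>k\<close> modulo it; but \<open>k - 1\<close> is also a label.\<close>

lemma gap_labelling_coprime:
  assumes "k \<ge> 1" and L: "gap_labelling k x y L"
  shows "coprime x y"
proof -
  note LD = gap_labellingD[OF L]
  define g where "g = gcd x y"
  have gap: "g dvd gap_step k x y j - j" for j
    by (auto simp: gap_step_def g_def)
  have "g dvd L i - k" if "0 \<le> i" "i \<le> k" for i
    using that
  proof (induction i rule: int_ge_induct)
    case base
    then show ?case using LD(5)[of k] gap[of k] LD(3) by simp
  next
    case (step i)
    then have "L (i + 1) = gap_step k x y (L i)" using LD(5)[of i] by simp
    moreover have "g dvd (gap_step k x y (L i) - L i) + (L i - k)"
      using step by (intro dvd_add gap) simp
    ultimately show ?case by simp
  qed
  moreover have "k - 1 \<in> L ` {0..k}" using LD(2) assms(1) by simp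
  then obtain i where "i \<in> {0..k}" "L i = k - 1" by (metis imageE)
  ultimately have "g dvd (k - 1) - k" by (metis atLeastAtMost_iff)
  then have "g dvd 1" by simp
  then show ?thesis by (simp add: g_def coprime_iff_gcd_eq_1)
qed

section \<open>From coprime pairs back to Hamiltonian paths\<close>

lemma gap_step_in:
  assumes "x \<in> {1..k}" "y \<in> {1..k}" "j \<in> {0..k}"
  shows "gap_step k x y j \<in> {0..k}"
  using assms by (auto simp: gap_step_def)

lemma gap_step_inj:
  assumes "x \<in> {1..k}" "y \<in> {1..k}" "x + y > k"
  shows "inj_on (gap_step k x y) {0..k}"
  using assms by (intro inj_onI) (auto simp: gap_step_def split: if_splits)

lemma gap_step_eq_0_iff:
  assumes "x \<in> {1..k}" "y \<in> {1..k}" "x + y > k" "j \<in> {0..k}"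
  shows "gap_step k x y j = 0 \<longleftrightarrow> j = x"
  using assms by (auto simp: gap_step_def)

lemma gap_step_eq_k_iff:
  assumes "x \<in> {1..k}" "y \<in> {1..k}" "j \<in> {0..k}"
  shows "gap_step k x y j = k \<longleftrightarrow> j = k - y"
  using assms by (auto simp: gap_step_def)

lemma multiples_mod_coprime:
  fixes a m j :: int
  assumes "coprime a m" "m > 0" "j \<in> {0..<m}"
  obtains n :: nat where "(b + int n * a) mod m = j"
proof -
  obtain u where u: "[a * u = 1] (mod m)"
    using cong_solve_coprime_int[OF assms(1)] by blast
  define n where "n = nat (((j - b) * u) mod m)"
  have "[b + int n * a = b + (j - b) * u * a] (mod m)"
    using assms(2) by (intro cong_add cong_mult) (auto simp: n_def Cong.cong_def)
  also have "b + (j - b) * u * a = b + (j - b) * (a * u)" by (simp add: mult_ac)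
  also have "[\<dots> = b + (j - b) * 1] (mod m)"
    using u by (intro cong_add cong_mult cong_refl)
  finally have "(b + int n * a) mod m = j"
    using assms(3) by (simp add: Cong.cong_def)
  then show thesis by (rule that)
qed

text \<open>On \<open>{0..k}\<close> the map \<open>gap_step k x y\<close> is the first return map of the rotation by \<open>y\<close>
  on the integers modulo \<open>x + y\<close>.\<close>

lemma gap_step_transitive:
  assumes x: "x \<in> {1..k}" and y: "y \<in> {1..k}" and "x + y > k" "coprime x y"
    and A: "A \<subseteq> {0..k}" "k \<in> A" "gap_step k x y ` A \<subseteq> A"
  shows "A = {0..k}"
proof -
  \<comment> \<open>The added points are the excursions of the rotation beyond \<open>k\<close>:
    from \<open>j\<close> in the middle interval it visits \<open>j + y\<close> and then returns to
    \<open>j + y - x\<close>.\<close>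
  define B where "B = A \<union> {j + y |j. j \<in> A \<and> j < x \<and> j + y > k}"
  have A_in: "0 \<le> j" "j \<le> k" "gap_step k x y j \<in> A" if "j \<in> A" for j
    using that A by auto
  have step: "(j + y) mod (x + y) \<in> B" if "j \<in> B" for j
  proof -
    have rot: "(j + y) mod (x + y) = (if j < x then j + y else j - x)"
      if "0 \<le> j" "j < x + y"
    proof (cases "j < x")
      case False
      have "(j + y) mod (x + y) = (j - x + (x + y)) mod (x + y)" by simp
      also have "\<dots> = (j - x) mod (x + y)" by (rule mod_add_self2)
      also have "\<dots> = j - x" using False that x by (intro mod_pos_pos_trivial) auto
      finally show ?thesis using False by simp
    qed (use that y in simp)
    from \<open>j \<in> B\<close> consider "j \<in> A" | i where "j = i + y" "i \<in> A" "i < x" "i + y > k"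
      by (auto simp: B_def)
    then show ?thesis
    proof cases
      case 1
      then show ?thesis
        using rot A_in[OF 1] x y \<open>x + y > k\<close> by (auto simp: gap_step_def B_def split: if_splits)
    next
      case 2
      then show ?thesis
        using rot A_in[OF 2(2)] x y \<open>x + y > k\<close> by (auto simp: gap_step_def B_def split: if_splits)
    qed
  qed
  have orbit: "(k + int n * y) mod (x + y) \<in> B" for n
  proof (induction n)
    case 0
    then show ?case using A(2) x y \<open>x + y > k\<close> by (simp add: B_def)
  next
    case (Suc n)
    have "k + int (Suc n) * y = k + int n * y + y" by (simp add: algebra_simps)
    then show ?case using step[OF Suc] by (simp only: mod_add_left_eq)
  qed
  have "coprime y (x + y)"
    using \<open>coprime x y\<close> by (metis add.commute coprime_iff_gcd_eq_1 gcd.commute gcd_add2)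
  moreover have "x + y > 0" using x y by simp
  ultimately have "j \<in> B" if "j \<in> {0..k}" for j
    using multiples_mod_coprime[of y "x + y" j k] orbit that \<open>x + y > k\<close>
    by (metis atLeastAtMost_iff atLeastLessThan_iff le_less_trans)
  moreover have "j \<in> A" if "j \<in> B" "j \<in> {0..k}" for j using that by (auto simp: B_def)
  ultimately show ?thesis using A(1) by blast
qed

lemma ex_gap_labelling:
  assumes "k \<ge> 1" "x \<in> {1..k}" "y \<in> {1..k}" "x + y > k" "coprime x y"
  obtains L where "gap_labelling k x y L"
proof -
  obtain L where "bij_betw L {0..k} {0..k}" "L k = k"
    "\<And>i. i \<in> {0..k} \<Longrightarrow> L ((i + 1) mod (k + 1)) = gap_step k x y (L i)"
  proof (rule cyclic_enumeration[of k "gap_step k x y"])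
    show "gap_step k x y ` {0..k} \<subseteq> {0..k}" using gap_step_in assms by blast
    show "inj_on (gap_step k x y) {0..k}" using gap_step_inj assms by blast
    show "A = {0..k}" if "A \<subseteq> {0..k}" "k \<in> A" "gap_step k x y ` A \<subseteq> A" for A
      using gap_step_transitive assms that by blast
  qed (use assms(1) in auto)
  then show thesis by (intro that[of L]) (simp add: gap_labelling_def)
qed

text \<open>The last edge has to start at label \<open>x - 1\<close>, and label 0 has to sit at the
  residue of \<open>c - 2\<close>. These two conditions determine \<open>c\<close>; the edges are
  then verified from the last one downwards.\<close>

lemma link_labelling_if_gap_labelling:
  assumes "k \<ge> 1" and x: "x \<in> {1..k}" and y: "y \<in> {1..k}" and xy: "x + y > k"
    and L: "gap_labelling k x y L"
  obtains c where "link_labelling k c L"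
proof -
  note LD = gap_labellingD[OF L]
  have "0 \<in> L ` {0..k}" "x - 1 \<in> L ` {0..k}" using LD(2) x assms(1) by auto
  then obtain w s where w: "w \<in> {0..k}" "L w = 0" and s: "s \<in> {0..k}" "L s = x - 1" by auto
  from s x LD(3) have "s \<noteq> k" by auto
  with s have s': "s \<in> {0..<k}" by auto
  \<comment> \<open>The explicit Chinese remainder solution of \<open>c\<close> congruent to
    \<open>s + 1\<close> modulo \<open>k\<close> and to \<open>w + 2\<close> modulo
    \<open>k + 1\<close>.\<close>
  define c where "c = (s + 1) * (k + 1) - (w + 2) * k"
  have c_k: "(c - 1) mod k = s"
  proof -
    have "c - 1 = s + (s - w - 1) * k" by (simp add: c_def algebra_simps)
    then show ?thesis using s' by simp
  qed
  have c_k1: "(c - 2) mod (k + 1) = w"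
  proof -
    have "c - 2 = w + (s - w - 1) * (k + 1)" by (simp add: c_def algebra_simps)
    then show ?thesis using w by simp
  qed
  have L_last: "L (k - 1) = k - y"
    using LD(5)[of "k - 1"] LD(3) LD(4)[of "k - 1"] gap_step_eq_k_iff[of x k y "L (k - 1)"] x y assms(1)
    by simp
  have L_0: "L 0 = k - x"
    using LD(5)[of k] LD(3) x y assms(1) by (simp add: gap_step_def)
  have next_v: "L (i mod (k + 1)) = gap_step k x y (L ((i - 1) mod (k + 1)))"
    and v_in: "L ((i - 1) mod (k + 1)) \<in> {0..k}" for i
  proof -
    have "(i - 1) mod (k + 1) \<in> {0..k}"
      using assms(1) pos_mod_bound[of "k + 1" "i - 1"] by auto
    then show "L (i mod (k + 1)) = gap_step k x y (L ((i - 1) mod (k + 1)))"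
      "L ((i - 1) mod (k + 1)) \<in> {0..k}"
      using LD(4,5)[of "(i - 1) mod (k + 1)"] by (simp_all add: mod_add_left_eq)
  qed
  have link: "L ((c + k - 1 - int n - 1) mod (k + 1)) = L ((c + k - 1 - int n) mod k) + 1"
    if "int n < k" for n
    using that
  proof (induction n)
    case 0
    have "(c + k - 1) mod (k + 1) = w"
      using mod_add_self2[of "c - 2" "k + 1"] c_k1 by (simp add: algebra_simps)
    then have "gap_step k x y (L ((c + k - 1 - 1) mod (k + 1))) = 0"
      using next_v[of "c + k - 1"] w by simp
    then have "L ((c + k - 1 - 1) mod (k + 1)) = x"
      using gap_step_eq_0_iff[OF x y xy v_in, of "c + k - 1"] by simp
    moreover have "(c + k - 1) mod k = s"
      using mod_add_self2[of "c - 1" k] c_k by (simp add: algebra_simps)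
    ultimately show ?case using s by simp
  next
    case (Suc n)
    define i where "i = c + k - 1 - int (Suc n)"
    define r where "r = i mod k"
    have r: "r \<in> {0..<k}" using assms(1) by (simp add: r_def)
    have "r \<noteq> s"
    proof
      assume "r = s"
      then have "k dvd i - (c - 1)"
        using c_k unfolding r_def by (metis mod_eq_dvd_iff)
      then show False
        using zdvd_not_zless[of "i - (c - 1)" k] Suc.prems by (auto simp: i_def)
    qed
    then have j_x: "L r \<noteq> x - 1"
      using s r inj_onD[OF LD(1), of r s] by auto
    have j_k: "L r < k"
      using r LD(4)[of r] LD(3) inj_onD[OF LD(1), of r k] by force
    have j_y: "L r = k - y \<longleftrightarrow> r = k - 1"
      using r L_last inj_onD[OF LD(1), of r "k - 1"] by auto
    have IH: "L (i mod (k + 1)) = L ((i + 1) mod k) + 1"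
      using Suc by (simp add: i_def algebra_simps)
    \<comment> \<open>The equation for edge \<open>i\<close> is compared after one application of
      the injective \<open>gap_step\<close>, where the edge \<open>i + 1\<close> is already
      known.\<close>
    have "gap_step k x y (L ((i - 1) mod (k + 1))) = gap_step k x y (L r + 1)"
    proof (cases "r = k - 1")
      case True
      then have "(i + 1) mod k = 0" using assms(1) mod_Suc_int[of k i] by (simp add: r_def)
      then have "gap_step k x y (L ((i - 1) mod (k + 1))) = k - x + 1"
        using next_v[of i] IH L_0 by simp
      then show ?thesis using True j_y j_x xy by (auto simp: gap_step_def)
    next
      case False
      then have "(i + 1) mod k = r + 1" using assms(1) mod_Suc_int[of k i] by (simp add: r_def)
      then have "gap_step k x y (L ((i - 1) mod (k + 1))) = L (r + 1) + 1"
        using next_v[of i] IH by simp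
      also have "L (r + 1) = gap_step k x y (L r)"
        using LD(5)[of r] r by simp
      \<comment> \<open>\<open>gap_step\<close> commutes with adding one except at the breakpoints
        \<open>k - y\<close> and \<open>x - 1\<close>, which belong to the vertices
        \<open>k - 1\<close> and \<open>s\<close>.\<close>
      also have "gap_step k x y (L r) + 1 = gap_step k x y (L r + 1)"
        using False j_y j_x j_k by (auto simp: gap_step_def)
      finally show ?thesis .
    qed
    then have "L ((i - 1) mod (k + 1)) = L r + 1"
      using inj_onD[OF gap_step_inj[OF x y xy]] v_in[of i] j_k LD(4)[of r] r by auto
    then show ?case by (simp add: i_def r_def)
  qed
  have "L ((i - 1) mod (k + 1)) = L (i mod k) + 1" if "i \<in> {c..<c + k}" for i
    using link[of "nat (c + k - 1 - i)"] that by simp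
  then show thesis
    using L by (intro that[of c]) (auto simp: link_labelling_def gap_labelling_def)
qed

section \<open>Counting the shifts with a connected graph\<close>

lemma link_labelling_mod:
  assumes "link_labelling k c L"
  shows "link_labelling k (c mod (k * (k + 1))) L"
proof -
  define q where "q = c div (k * (k + 1))"
  have c: "c mod (k * (k + 1)) = c - q * (k * (k + 1))"
    by (simp add: q_def minus_div_mult_eq_mod)
  have shift: "(i + q * (k * (k + 1))) mod k = i mod k"
    "(i + q * (k * (k + 1)) - 1) mod (k + 1) = (i - 1) mod (k + 1)" for i
    using mod_mult_self1[of "i - 1" "q * k" "k + 1"] mod_mult_self2[of i k "q * (k + 1)"]
    by (simp_all only: diff_add_eq mult_ac)
  have "L ((i - 1) mod (k + 1)) = L (i mod k) + 1"
    if "i \<in> {c mod (k * (k + 1))..<c mod (k * (k + 1)) + k}" for i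
    using link_labellingD(5)[OF assms, of "i + q * (k * (k + 1))"] that unfolding c shift by auto
  then show ?thesis using assms by (auto simp: link_labelling_def)
qed

lemma gap_labelling_unique:
  assumes "k \<ge> 1" "gap_labelling k x y L" "gap_labelling k x y L'" "0 \<le> i" "i \<le> k"
  shows "L i = L' i"
  using assms(4,5)
proof (induction i rule: int_ge_induct)
  case base
  then show ?case
    using gap_labellingD(5)[OF assms(2), of k] gap_labellingD(5)[OF assms(3), of k]
      gap_labellingD(3)[OF assms(2)] gap_labellingD(3)[OF assms(3)] assms(1) by simp
next
  case (step i)
  then show ?case
    using gap_labellingD(5)[OF assms(2), of i] gap_labellingD(5)[OF assms(3), of i] by simp
qed

lemma link_labelling_unique:
  assumes "k \<ge> 1" "link_labelling k c L" "link_labelling k c L'" "i \<in> {0..k}"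
  shows "L i = L' i"
proof -
  note D = link_labellingD[OF assms(2)] and D' = link_labellingD[OF assms(3)]
  \<comment> \<open>The difference of two link labellings is constant along the edges, hence
    constant, and it vanishes at \<open>k\<close>.\<close>
  have "\<forall>i\<in>{c..<c + k}. real_of_int (L (i mod k) - L' (i mod k)) =
      real_of_int (L ((i - 1) mod (k + 1)) - L' ((i - 1) mod (k + 1)))"
    using D(5) D'(5) by simp
  then have "real_of_int (L i - L' i) = real_of_int (L k - L' k)"
    using links_connect_if_link_labelling[OF assms(1,2)] assms(4)
    unfolding links_connect_def by (elim allE[of _ "\<lambda>u. real_of_int (L u - L' u)"]) blast
  then show ?thesis using D(3) D'(3) by simp
qed

text \<open>The labels \<open>x - 1\<close> and 0 sit at \<open>(c - 1) mod k\<close> and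
  \<open>(c - 2) mod (k + 1)\<close>. As both labellings agree, \<open>c\<close> is determined
  modulo \<open>k\<close> and modulo \<open>k + 1\<close>, hence modulo their product.\<close>

lemma link_and_gap_labelling_determine_shift:
  assumes "k \<ge> 1" and x: "x \<in> {1..k}" and y: "y \<in> {1..k}" and xy: "x + y > k"
    and c: "c \<in> {0..<k * (k + 1)}" "link_labelling k c L" "gap_labelling k x y L"
    and c': "c' \<in> {0..<k * (k + 1)}" "link_labelling k c' L'" "gap_labelling k x y L'"
  shows "c = c'"
proof -
  have mod_in: "a mod (k + 1) \<in> {0..k}" "a mod k \<in> {0..k}" for a
    using assms(1) pos_mod_bound[of "k + 1" a] pos_mod_bound[of k a] by (auto intro: less_imp_le)
  have L_s: "L ((c - 1) mod k) = x - 1"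
    if "link_labelling k c L" "gap_labelling k x y L" for c L
  proof -
    have v: "L ((c + k - 2) mod (k + 1)) = L ((c - 1) mod k) + 1"
      using link_labellingD(5)[OF that(1), of "c + k - 1"] mod_add_self2[of "c - 1" k] assms(1)
      by (simp add: algebra_simps)
    have "gap_step k x y (L ((c + k - 2) mod (k + 1))) = L ((c + k - 2 + 1) mod (k + 1))"
      using gap_labellingD(5)[OF that(2) mod_in(1), of "c + k - 2"] by (simp only: mod_add_left_eq)
    also have "\<dots> = 0"
      using link_labelling_0[OF assms(1) that(1)] mod_add_self2[of "c - 2" "k + 1"]
      by (simp add: algebra_simps)
    finally have "L ((c + k - 2) mod (k + 1)) = x"
      using gap_step_eq_0_iff[OF x y xy] gap_labellingD(4)[OF that(2) mod_in(1)] by simp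
    then show ?thesis using v by simp
  qed
  have eq: "L i = L' i" if "i \<in> {0..k}" for i
    using gap_labelling_unique[OF assms(1) c(3) c'(3)] that by simp
  have "L ((c - 1) mod k) = L ((c' - 1) mod k)"
    using L_s[OF c(2,3)] L_s[OF c'(2,3)] eq[OF mod_in(2)] by simp
  then have "(c - 1) mod k = (c' - 1) mod k"
    using gap_labellingD(1)[OF c(3)] mod_in by (auto dest: inj_onD)
  then have "k dvd c - c'" by (simp add: mod_eq_dvd_iff)
  have "L ((c - 2) mod (k + 1)) = L ((c' - 2) mod (k + 1))"
    using link_labelling_0[OF assms(1) c(2)] link_labelling_0[OF assms(1) c'(2)] eq[OF mod_in(1)] by simp
  then have "(c - 2) mod (k + 1) = (c' - 2) mod (k + 1)"
    using gap_labellingD(1)[OF c(3)] mod_in by (auto dest: inj_onD)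
  then have "k + 1 dvd c - c'" by (simp add: mod_eq_dvd_iff)
  with \<open>k dvd c - c'\<close> have "k * (k + 1) dvd c - c'"
    by (intro divides_mult) auto
  then have "c mod (k * (k + 1)) = c' mod (k * (k + 1))" by (simp add: mod_eq_dvd_iff)
  then show ?thesis using c(1) c'(1) by simp
qed

text \<open>Sharing a labelling is a relation between shifts and pairs that is total on both sides.
  A choice function in each direction is injective: the pair determines the shift, and the shift
  determines the labelling, from which the pair is read off.\<close>

lemma card_links_connect:
  assumes "k \<ge> 1"
  shows "card {c \<in> {0..<k * (k + 1)}. links_connect k c} = card (farey_denominators k)"
    (is "card ?Z = card ?Q")
proof (rule antisym)
  define R where "R c q \<longleftrightarrow> (\<exists>L. link_labelling k c L \<and> gap_labelling k (fst q) (snd q) L)" for c q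
  have fin: "finite ?Z" "finite ?Q"
    by (rule finite_subset[of _ "{0..<k * (k + 1)}"],
        auto simp: farey_denominators_def intro: finite_subset[of _ "{1..k} \<times> {1..k}"])
  have ex_Q: "\<exists>q\<in>?Q. R c q" if "c \<in> ?Z" for c
  proof -
    from that assms obtain L where L: "link_labelling k c L"
      using ex_link_labelling_if_links_connect by blast
    note G = gap_labelling_if_link_labelling[OF assms L]
    show ?thesis
      using G gap_labelling_coprime[OF assms G(1)] L
      by (intro bexI[of _ "(k - L 0, k - L (k - 1))"]) (auto simp: R_def farey_denominators_def)
  qed
  have ex_Z: "\<exists>c\<in>?Z. R c q" if "q \<in> ?Q" for q
  proof -
    obtain x y where q: "q = (x, y)" by fastforce
    with that have xy: "x \<in> {1..k}" "y \<in> {1..k}" "x + y > k" "coprime x y"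
      by (auto simp: farey_denominators_def)
    obtain L where L: "gap_labelling k x y L" by (rule ex_gap_labelling[OF assms xy])
    obtain c where "link_labelling k c L"
      by (rule link_labelling_if_gap_labelling[OF assms xy(1-3) L])
    then have c: "link_labelling k (c mod (k * (k + 1))) L" by (rule link_labelling_mod)
    have "k * (k + 1) > 0" using assms by simp
    then show ?thesis
      using c L links_connect_if_link_labelling[OF assms c]
      by (intro bexI[of _ "c mod (k * (k + 1))"]) (auto simp: R_def q)
  qed
  define F where "F c = (SOME q. q \<in> ?Q \<and> R c q)" for c
  have F: "F c \<in> ?Q" "R c (F c)" if "c \<in> ?Z" for c
    using someI_ex[of "\<lambda>q. q \<in> ?Q \<and> R c q"] ex_Q[OF that] by (auto simp: F_def)
  have "inj_on F ?Z"
  proof (rule inj_onI)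
    fix c c' assume c: "c \<in> ?Z" and c': "c' \<in> ?Z" and "F c = F c'"
    then have "R c (F c)" "R c' (F c)" "F c \<in> ?Q" using F[of c] F[of c'] by auto
    then show "c = c'"
      using c c' link_and_gap_labelling_determine_shift[OF assms]
      by (fastforce simp: R_def farey_denominators_def)
  qed
  then show "card ?Z \<le> card ?Q" using F(1) fin by (intro card_inj_on_le) auto
  define G where "G q = (SOME c. c \<in> ?Z \<and> R c q)" for q
  have G: "G q \<in> ?Z" "R (G q) q" if "q \<in> ?Q" for q
    using someI_ex[of "\<lambda>c. c \<in> ?Z \<and> R c q"] ex_Z[OF that] by (auto simp: G_def)
  have determined: "q = (k - L 0, k - L (k - 1))" if "q \<in> ?Q" "gap_labelling k (fst q) (snd q) L" for q L
  proof -
    note LD = gap_labellingD[OF that(2)]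
    have q: "fst q \<in> {1..k}" "snd q \<in> {1..k}" using that(1) by (auto simp: farey_denominators_def)
    have "L 0 = k - fst q" using LD(5)[of k] LD(3) q assms by (simp add: gap_step_def)
    moreover have "L (k - 1) = k - snd q"
      using LD(5)[of "k - 1"] LD(3) LD(4)[of "k - 1"] gap_step_eq_k_iff[OF q, of "L (k - 1)"] assms
      by simp
    ultimately show ?thesis by (simp add: prod_eq_iff)
  qed
  have "inj_on G ?Q"
  proof (rule inj_onI)
    fix q q' assume q: "q \<in> ?Q" and q': "q' \<in> ?Q" and eq: "G q = G q'"
    obtain L where L: "link_labelling k (G q) L" "gap_labelling k (fst q) (snd q) L"
      using G(2)[OF q] by (auto simp: R_def)
    obtain L' where L': "link_labelling k (G q) L'" "gap_labelling k (fst q') (snd q') L'"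
      using G(2)[OF q'] eq by (auto simp: R_def)
    show "q = q'"
      using determined[OF q L(2)] determined[OF q' L'(2)] assms
        link_labelling_unique[OF assms L(1) L'(1), of 0] link_labelling_unique[OF assms L(1) L'(1), of "k - 1"]
      by simp
  qed
  then show "card ?Q \<le> card ?Z" using G(1) fin by (intro card_inj_on_le) auto
qed

section \<open>The summatory totient function\<close>

definition totient_sum :: "nat \<Rightarrow> nat" where
  "totient_sum n = (\<Sum>j=1..n. totient j)"

section \<open>Exact formulas for the totient sum\<close>

text \<open>Raising the order from \<open>n - 1\<close> to \<open>n\<close> removes the coprime
  pairs with sum \<open>n\<close> and adds those with a coordinate equal to \<open>n\<close>. For
  \<open>n \<ge> 2\<close> one family of size \<open>totient n\<close> is lost and two are
  gained.\<close>

lemma card_farey_denominators: "card (farey_denominators (int k)) = totient_sum k"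
proof (induction k)
  case 0
  then show ?case by (simp add: farey_denominators_def totient_sum_def)
next
  case (Suc k)
  define n where "n = int (Suc k)"
  show ?case
  proof (cases "k = 0")
    case True
    have "farey_denominators 1 = {(1, 1)}" by (auto simp: farey_denominators_def)
    then show ?thesis using True by (simp add: totient_sum_def)
  next
    case False
    then have n: "n \<ge> 2" "int k = n - 1" by (auto simp: n_def)
    define T where "T = {x \<in> {1..n}. coprime x n}"
    have "T = int ` totatives (Suc k)"
    proof (intro equalityI subsetI)
      fix x assume x: "x \<in> T"
      then have "x \<ge> 0" by (simp add: T_def)
      then obtain m where m: "x = int m" by (rule nonneg_int_cases)
      have "m \<in> totatives (Suc k)"
        using x unfolding T_def n_def m totatives_def by (simp del: of_nat_Suc)
      then show "x \<in> int ` totatives (Suc k)" using m by blast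
    next
      fix x assume "x \<in> int ` totatives (Suc k)"
      then obtain m where "x = int m" "m \<in> totatives (Suc k)" by blast
      then show "x \<in> T" unfolding T_def n_def totatives_def by (simp del: of_nat_Suc)
    qed
    then have T: "card T = totient (Suc k)" "finite T"
      by (simp_all add: totient_def card_image)
    \<comment> \<open>For \<open>n \<ge> 2\<close>, \<open>n\<close> is not coprime to itself; this
      keeps \<open>Sa\<close> and \<open>Sb\<close> disjoint and the second coordinates in
      \<open>Sd\<close> positive.\<close>
    have T_lt: "x < n" if "x \<in> T" for x
      using that n by (cases "x = n") (auto simp: T_def)
    have fin: "finite (farey_denominators j)" for j
      by (rule finite_subset[of _ "{1..j} \<times> {1..j}"]) (auto simp: farey_denominators_def)
    define Sa where "Sa = Pair n ` T"
    define Sb where "Sb = (\<lambda>x. (x, n)) ` T"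
    define Sd where "Sd = (\<lambda>x. (x, n - x)) ` T"
    have card_S: "card Sa = totient (Suc k)" "card Sb = totient (Suc k)" "card Sd = totient (Suc k)"
      unfolding Sa_def Sb_def Sd_def using T(1) by (simp_all add: card_image inj_on_def)
    have fin_S: "finite Sa" "finite Sb" "finite Sd"
      using T(2) by (simp_all add: Sa_def Sb_def Sd_def)
    have disjoint: "farey_denominators (n - 1) \<inter> (Sa \<union> Sb) = {}"
      by (auto simp: farey_denominators_def Sa_def Sb_def)
    have "card (farey_denominators n \<union> Sd) = card (farey_denominators n) + totient (Suc k)"
      using fin fin_S card_S by (subst card_Un_disjoint) (auto simp: farey_denominators_def Sd_def)
    moreover have "card (Sa \<union> Sb) = totient (Suc k) + totient (Suc k)"
      using fin_S card_S T_lt by (subst card_Un_disjoint) (auto simp: Sa_def Sb_def)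
    then have "card (farey_denominators (n - 1) \<union> (Sa \<union> Sb)) =
        card (farey_denominators (n - 1)) + (totient (Suc k) + totient (Suc k))"
      using fin fin_S disjoint by (simp add: card_Un_disjoint)
    moreover have "farey_denominators n \<union> Sd = farey_denominators (n - 1) \<union> (Sa \<union> Sb)"
    proof (rule Set.set_eqI)
      fix z :: "int \<times> int"
      obtain x y where z: "z = (x, y)" by fastforce
      have coprime_sum: "coprime x (x + y) \<longleftrightarrow> coprime x y"
        by (metis coprime_iff_gcd_eq_1 gcd_add2)
      have Sd: "z \<in> Sd \<longleftrightarrow> x \<ge> 1 \<and> y \<ge> 1 \<and> x + y = n \<and> coprime x y"
      proof
        assume "z \<in> Sd"
        then have "x \<in> T" "x + y = n" by (auto simp: Sd_def z)
        moreover from this have "coprime x (x + y)" by (simp add: T_def)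
        ultimately show "x \<ge> 1 \<and> y \<ge> 1 \<and> x + y = n \<and> coprime x y"
          using T_lt[of x] coprime_sum by (auto simp: T_def)
      next
        assume *: "x \<ge> 1 \<and> y \<ge> 1 \<and> x + y = n \<and> coprime x y"
        then have "coprime x (x + y)" using coprime_sum by simp
        with * have "x \<in> T" "y = n - x" by (auto simp: T_def)
        then show "z \<in> Sd" by (simp add: Sd_def z)
      qed
      have Sab: "z \<in> Sa \<union> Sb \<longleftrightarrow> coprime x y \<and> x \<in> {1..n} \<and> y \<in> {1..n} \<and> (x = n \<or> y = n)"
        using n by (auto simp: Sa_def Sb_def T_def z coprime_commute)
      show "z \<in> farey_denominators n \<union> Sd \<longleftrightarrow> z \<in> farey_denominators (n - 1) \<union> (Sa \<union> Sb)"
        unfolding Un_iff[of z _ Sd] Un_iff[of z _ "Sa \<union> Sb"] Sd Sab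
        using n by (auto simp: farey_denominators_def z)
    qed
    ultimately have "card (farey_denominators n) = card (farey_denominators (int k)) + totient (Suc k)"
      using n by simp
    then show ?thesis using Suc by (simp add: n_def totient_sum_def)
  qed
qed

text \<open>Each \<open>m\<close> is the sum of \<open>totient e\<close> over its divisors
  \<open>e\<close>; the double sum is regrouped by the cofactor \<open>d = m div e\<close>.\<close>

lemma sum_totient_sum_div:
  "(\<Sum>d=1..n. totient_sum (n div d)) = (\<Sum>m=1..n. m)"
proof -
  have "(\<Sum>m=1..n. m) = (\<Sum>m=1..n. \<Sum>e | e dvd m. totient e)"
    by (simp add: totient_divisor_sum)
  also have "\<dots> = (\<Sum>(m, e)\<in>(SIGMA m:{1..n}. {e. e dvd m}). totient e)"
    by (rule sum.Sigma) auto
  also have "\<dots> = (\<Sum>(d, e)\<in>(SIGMA d:{1..n}. {1..n div d}). totient e)"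
  proof (rule sum.reindex_bij_witness[of _ "\<lambda>(d, e). (d * e, e)" "\<lambda>(m, e). (m div e, e)"])
    fix z assume "z \<in> (SIGMA d:{1..n}. {1..n div d})"
    then obtain d e where z: "z = (d, e)" "1 \<le> d" "1 \<le> e" "e \<le> n div d" by auto
    have "d * e \<le> n"
      using mult_le_mono2[OF z(4), of d] by (meson le_trans times_div_less_eq_dividend)
    with z show "(case z of (d, e) \<Rightarrow> (d * e, e)) \<in> (SIGMA m:{1..n}. {e. e dvd m})"
      by auto
  next
    fix z assume "z \<in> (SIGMA m:{1..n}. {e. e dvd m})"
    then obtain m e where z: "z = (m, e)" "1 \<le> m" "m \<le> n" "e dvd m" by auto
    then obtain d where d: "m = e * d" by blast
    with z have "d > 0" "e > 0" by auto
    moreover have "d \<le> n" using z d \<open>e > 0\<close>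
      by (metis dvd_imp_le dvd_triv_right le_trans less_le_trans less_one)
    moreover have "e \<le> n div d"
      using z d \<open>d > 0\<close> by (simp add: less_eq_div_iff_mult_less_eq)
    ultimately show "(case z of (m, e) \<Rightarrow> (m div e, e)) \<in> (SIGMA d:{1..n}. {1..n div d})"
      using z d by auto
  qed auto
  also have "\<dots> = (\<Sum>d=1..n. totient_sum (n div d))"
    unfolding totient_sum_def by (rule sum.Sigma[symmetric]) auto
  finally show ?thesis by simp
qed

lemma totient_sum_le: "totient_sum n \<le> n ^ 2"
proof -
  have "totient_sum n \<le> (\<Sum>j=1..n. n)"
    unfolding totient_sum_def by (intro sum_mono) (auto intro: order.trans[OF totient_le])
  then show ?thesis by (simp add: power2_eq_square)
qed

section \<open>Asymptotics of the totient sum\<close>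

lemma inverse_squares_sums': "(\<lambda>i. 1 / (real i + 1)\<^sup>2) sums (pi\<^sup>2 / 6)"
  using inverse_squares_sums by (simp add: add_ac)

text \<open>The first term is 1/4, and the later ones are bounded by a series telescoping to 1/2. A
  total below 1 is what makes the later recursion contract.\<close>

lemma inverse_squares_from_2:
  "summable (\<lambda>i. 1 / (real i + 2)\<^sup>2)" "(\<Sum>i. 1 / (real i + 2)\<^sup>2) \<le> 3 / 4"
proof -
  have "summable (\<lambda>i. 1 / (real (i + 1) + 1)\<^sup>2)"
    using inverse_squares_sums'[THEN sums_summable] by (rule summable_ignore_initial_segment)
  then show s: "summable (\<lambda>i. 1 / (real i + 2)\<^sup>2)" by (simp add: add_ac)
  have *: "(\<Sum>i<Suc n. 1 / (real i + 2)\<^sup>2) \<le> 3 / 4 - 1 / (real n + 2)" for n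
  proof (induction n)
    case (Suc n)
    have "1 / (real n + 3)\<^sup>2 \<le> 1 / ((real n + 2) * (real n + 3))"
      unfolding power2_eq_square by (intro divide_left_mono mult_right_mono) auto
    also have "\<dots> = 1 / (real n + 2) - 1 / (real n + 3)"
      by (simp add: field_simps)
    finally have "1 / (real n + 3)\<^sup>2 \<le> 1 / (real n + 2) - 1 / (real n + 3)" .
    with Suc show ?case by (simp add: algebra_simps)
  qed (simp add: power2_eq_square)
  have "(\<Sum>i<n. 1 / (real i + 2)\<^sup>2) \<le> 3 / 4" for n
  proof (cases n)
    case (Suc m)
    have "1 / (real m + 2) \<ge> 0" by simp
    with *[of m] show ?thesis unfolding Suc by linarith
  qed simp
  with s show "(\<Sum>i. 1 / (real i + 2)\<^sup>2) \<le> 3 / 4"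
    by (intro suminf_le_const) auto
qed

lemma real_div_ratio_le: "real (n div d) / real n \<le> 1 / real d"
proof (cases "n = 0 \<or> d = 0")
  case False
  then show ?thesis
    using of_nat_div_le_of_nat[of n d, where 'a = real] by (simp add: field_simps)
qed auto

lemma real_div_ratio_tendsto:
  assumes "d > 0"
  shows "(\<lambda>n. real (n div d) / real n) \<longlonglongrightarrow> 1 / real d"
proof (rule tendsto_sandwich[where h = "\<lambda>_. 1 / real d"])
  show "\<forall>\<^sub>F n in sequentially. 1 / real d - 1 / real n \<le> real (n div d) / real n"
    using eventually_gt_at_top[of 0]
  proof eventually_elim
    case (elim n)
    have "real n / real d - 1 \<le> real (n div d)"
      using floor_correct[of "real n / real d"] by (simp add: floor_divide_of_nat_eq)
    then have "(real n / real d - 1) / real n \<le> real (n div d) / real n"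
      by (rule divide_right_mono) simp
    with elim show ?case by (simp add: diff_divide_distrib)
  qed
  have "(\<lambda>n. 1 / real d - 1 / real n) \<longlonglongrightarrow> 1 / real d - 0"
    by (intro tendsto_intros lim_1_over_n)
  then show "(\<lambda>n. 1 / real d - 1 / real n) \<longlonglongrightarrow> 1 / real d" by simp
qed (auto intro: always_eventually real_div_ratio_le)

text \<open>By the identity \<open>sum_totient_sum_div\<close>, the deviations \<open>e n\<close> of \<open>totient_sum n / n\<^sup>2\<close> from its
  limit satisfy \<open>\<bar>e n\<bar> \<le> o(1) + (\<Sum>d\<ge>2. \<bar>e (n div d)\<bar> / d\<^sup>2)\<close>. Since \<open>(\<Sum>d\<ge>2. 1 / d\<^sup>2) < 1\<close>, this forces
  \<open>limsup \<bar>e n\<bar> = 0\<close>.\<close>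

lemma totient_sum_asymptotics:
  "(\<lambda>n. real (totient_sum n) / real n ^ 2) \<longlonglongrightarrow> 3 / pi ^ 2"
proof -
  define e where "e n = real (totient_sum n) / real n ^ 2 - 3 / pi ^ 2" for n
  define w where "w i n = (real (n div Suc i) / real n)\<^sup>2" for i n
  \<comment> \<open>The error left in the divided identity \<open>sum_totient_sum_div\<close> when
    every totient sum is replaced by \<open>3 / pi ^ 2\<close> times the square of its
    argument.\<close>
  define \<delta> where "\<delta> n = (1 / 2 + 1 / (2 * real n)) - 3 / pi ^ 2 * (\<Sum>i. w i n)" for n
  \<comment> \<open>The tail supremum decreases in \<open>n\<close>, so it converges, and its limit
    is the limsup of \<open>\<bar>e n\<bar>\<close>.\<close>
  define M where "M n = (SUP m\<in>{n..}. \<bar>e m\<bar>)" for n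

  have w_le: "w i n \<le> 1 / (real i + 1)\<^sup>2" and w_nonneg: "w i n \<ge> 0" for i n
    using power_mono[OF real_div_ratio_le[of n "Suc i"], of 2]
    by (auto simp: w_def power_divide add_ac)
  have w_0: "w i n = 0" if "i \<ge> n" for i n
    using that by (simp add: w_def div_less)
  have w_sum: "(\<Sum>i. w i n * f i) = (\<Sum>i<n. w i n * f i)" for n and f :: "nat \<Rightarrow> real"
    by (rule suminf_finite) (auto simp: w_0)
  have w_lim: "(\<lambda>n. \<Sum>i. w i n) \<longlonglongrightarrow> (\<Sum>i. 1 / (real i + 1)\<^sup>2)"
  proof (rule tannerys_theorem[THEN conjunct2, THEN conjunct2])
    show "w i \<longlonglongrightarrow> 1 / (real i + 1)\<^sup>2" for i
      using tendsto_power[OF real_div_ratio_tendsto[of "Suc i"], of 2]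
      by (simp add: w_def[abs_def] power_divide add_ac)
    show "\<forall>\<^sub>F (i, n) in sequentially \<times>\<^sub>F sequentially. norm (w i n) \<le> 1 / (real i + 1)\<^sup>2"
      using w_le w_nonneg by (intro always_eventually) auto
    show "summable (\<lambda>i. 1 / (real i + 1)\<^sup>2)"
      using inverse_squares_sums' by (rule sums_summable)
  qed simp
  \<comment> \<open>The weights sum to \<open>pi ^ 2 / 6\<close> in the limit, so the constant
    \<open>3 / pi ^ 2\<close> is the one that cancels 1/2.\<close>
  have "\<delta> \<longlonglongrightarrow> (1 / 2 + 0) - 3 / pi ^ 2 * (pi ^ 2 / 6)"
    unfolding \<delta>_def using w_lim[unfolded sums_unique[OF inverse_squares_sums', symmetric]]
    by (intro tendsto_intros)
       (auto intro!: real_tendsto_divide_at_top filterlim_at_top_mult_tendsto_pos[of _ 2]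
          filterlim_real_sequentially simp: mult.commute)
  then have \<delta>_lim: "\<delta> \<longlonglongrightarrow> 0" by simp

  have e_bound: "\<bar>e n\<bar> \<le> 1" for n
  proof -
    have "real (totient_sum n) \<le> real n ^ 2"
      using totient_sum_le[of n] by (metis of_nat_le_iff of_nat_power)
    then have "real (totient_sum n) / real n ^ 2 \<le> 1"
      by (cases "n = 0") (simp_all add: divide_le_eq_1)
    moreover have "real (totient_sum n) / real n ^ 2 \<ge> 0" by simp
    moreover have "9 \<le> pi ^ 2" using power_mono[of 3 pi 2] pi_gt3 by simp
    then have "3 / pi ^ 2 \<le> 1" "3 / pi ^ 2 \<ge> 0" by (simp_all add: divide_le_eq_1)
    ultimately show ?thesis unfolding e_def by linarith
  qed
  then have bdd: "bdd_above ((\<lambda>m. \<bar>e m\<bar>) ` {n..})" for n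
    by (intro bdd_aboveI[of _ 1]) auto
  have e_le_M: "\<bar>e m\<bar> \<le> M n" if "n \<le> m" for m n
    unfolding M_def using that by (intro cSUP_upper bdd) auto
  have M_leI: "M n \<le> c" if "\<And>m. m \<ge> n \<Longrightarrow> \<bar>e m\<bar> \<le> c" for n c
    unfolding M_def using that by (intro cSUP_least) auto
  have M_nonneg: "M n \<ge> 0" and M_le_1: "M n \<le> 1" for n
    using e_le_M[of n n] M_leI[of n 1] e_bound by auto
  have "decseq M"
    using e_le_M by (intro decseq_SucI M_leI) auto
  then obtain u where u: "M \<longlonglongrightarrow> u" and M_ge: "\<And>n. u \<le> M n"
    using decseq_convergent[of M 0] M_nonneg by blast
  have "u \<ge> 0" using u M_nonneg by (intro LIMSEQ_le_const[OF u]) auto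

  have recursion: "\<bar>e n\<bar> \<le> \<bar>\<delta> n\<bar> + (\<Sum>i. M (n div (i + 2)) / (real i + 2)\<^sup>2)"
    if "n > 0" for n
  proof -
    have "(\<Sum>i<n. w i n * (e (n div Suc i) + 3 / pi ^ 2)) =
        (\<Sum>i<n. real (totient_sum (n div Suc i)) / real n ^ 2)"
      by (intro sum.cong) (auto simp: w_def e_def power_divide totient_sum_def)
    also have "\<dots> = real (\<Sum>d=1..n. totient_sum (n div d)) / real n ^ 2"
      unfolding sum_divide_distrib[symmetric] of_nat_sum[symmetric]
      by (simp add: sum.atLeast1_atMost_eq)
    also have "\<dots> = 1 / 2 + 1 / (2 * real n)"
      unfolding sum_totient_sum_div using that
      by (simp add: Sum_Icc_nat field_simps power2_eq_square)
         (simp add: real_of_nat_div algebra_simps)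
    finally have "\<delta> n = (\<Sum>i<n. w i n * e (n div Suc i))"
      using w_sum[of n "\<lambda>_. 1"]
      by (simp add: \<delta>_def ring_distribs sum.distrib sum_distrib_left sum_divide_distrib mult.commute)
    \<comment> \<open>A zero term is appended so that splitting off the first term, which is
      \<open>e n\<close> because \<open>w 0 n = 1\<close>, leaves a sum over
      \<open>i < n\<close>.\<close>
    also have "\<dots> = (\<Sum>i<Suc n. w i n * e (n div Suc i))"
      by (simp add: w_0)
    also have "\<dots> = e n + (\<Sum>i<n. w (Suc i) n * e (n div (i + 2)))"
      using that by (simp only: sum.lessThan_Suc_shift) (simp add: w_def)
    finally have "\<bar>e n\<bar> \<le> \<bar>\<delta> n\<bar> + \<bar>\<Sum>i<n. w (Suc i) n * e (n div (i + 2))\<bar>"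
      by linarith
    also have "\<bar>\<Sum>i<n. w (Suc i) n * e (n div (i + 2))\<bar> \<le>
        (\<Sum>i<n. M (n div (i + 2)) / (real i + 2)\<^sup>2)"
    proof (rule order.trans[OF sum_abs], rule sum_mono)
      fix i
      have "\<bar>w (Suc i) n\<bar> * \<bar>e (n div (i + 2))\<bar> \<le> 1 / (real i + 2)\<^sup>2 * M (n div (i + 2))"
        using w_le[of "Suc i" n] w_nonneg[of "Suc i" n]
        by (intro mult_mono e_le_M) (auto simp: add_ac)
      then show "\<bar>w (Suc i) n * e (n div (i + 2))\<bar> \<le> M (n div (i + 2)) / (real i + 2)\<^sup>2"
        by (simp add: abs_mult)
    qed
    also have "\<dots> \<le> (\<Sum>i. M (n div (i + 2)) / (real i + 2)\<^sup>2)"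
      using M_nonneg M_le_1
      by (intro sum_le_suminf summable_comparison_test'[OF inverse_squares_from_2(1), of 0])
         (auto simp: divide_right_mono)
    finally show ?thesis by simp
  qed

  have "(\<lambda>n. \<Sum>i. M (n div (i + 2)) / (real i + 2)\<^sup>2) \<longlonglongrightarrow> (\<Sum>i. u / (real i + 2)\<^sup>2)"
  proof (rule tannerys_theorem[THEN conjunct2, THEN conjunct2])
    show "(\<lambda>n. M (n div (i + 2)) / (real i + 2)\<^sup>2) \<longlonglongrightarrow> u / (real i + 2)\<^sup>2" for i
      by (intro tendsto_divide tendsto_const filterlim_compose[OF u]
            filterlim_at_top_div_const_nat) auto
    show "\<forall>\<^sub>F (i, n) in sequentially \<times>\<^sub>F sequentially.
        norm (M (n div (i + 2)) / (real i + 2)\<^sup>2) \<le> 1 / (real i + 2)\<^sup>2"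
      using M_nonneg M_le_1 by (intro always_eventually) (auto simp: divide_right_mono)
  qed (simp_all add: inverse_squares_from_2)
  also have "(\<Sum>i. u / (real i + 2)\<^sup>2) = u * (\<Sum>i. 1 / (real i + 2)\<^sup>2)"
    using suminf_mult[OF inverse_squares_from_2(1), of u] by simp
  finally have lim: "(\<lambda>n. \<bar>\<delta> n\<bar> + (\<Sum>i. M (n div (i + 2)) / (real i + 2)\<^sup>2))
      \<longlonglongrightarrow> 0 + u * (\<Sum>i. 1 / (real i + 2)\<^sup>2)"
    by (intro tendsto_add tendsto_rabs_zero \<delta>_lim)
  have "u = 0"
  proof (rule ccontr)
    assume "u \<noteq> 0"
    with \<open>u \<ge> 0\<close> have "u > 0" by simp
    then have "u * (\<Sum>i. 1 / (real i + 2)\<^sup>2) \<le> u * (3 / 4)"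
      by (intro mult_left_mono inverse_squares_from_2) auto
    \<comment> \<open>The gap between 3/4 and 4/5 leaves room for a strict inequality, and 4/5 is
      still below 1, against \<open>u \<le> M n0\<close>.\<close>
    with \<open>u > 0\<close> have "0 + u * (\<Sum>i. 1 / (real i + 2)\<^sup>2) < u * (4 / 5)" by linarith
    then have "\<forall>\<^sub>F n in sequentially.
        \<bar>\<delta> n\<bar> + (\<Sum>i. M (n div (i + 2)) / (real i + 2)\<^sup>2) < u * (4 / 5)"
      by (rule order_tendstoD(2)[OF lim])
    then have "\<forall>\<^sub>F n in sequentially. \<bar>e n\<bar> \<le> u * (4 / 5)"
      using eventually_gt_at_top[of 0]
    proof eventually_elim
      case (elim n)
      then show ?case using recursion[of n] by linarith
    qed
    then obtain n0 where "\<And>m. m \<ge> n0 \<Longrightarrow> \<bar>e m\<bar> \<le> u * (4 / 5)"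
      by (auto simp: eventually_at_top_linorder)
    then have "M n0 \<le> u * (4 / 5)" by (rule M_leI)
    with M_ge[of n0] \<open>u > 0\<close> show False by linarith
  qed
  have "e \<longlonglongrightarrow> 0"
    using u[unfolded \<open>u = 0\<close>] by (rule Lim_null_comparison[rotated]) (auto intro: always_eventually e_le_M)
  then show ?thesis
    unfolding e_def[abs_def] by (rule LIM_zero_cancel)
qed

section \<open>The limiting proportion\<close>

lemma P0_eq_totient_sum:
  assumes "k \<ge> 1"
  shows "P0 k = real (totient_sum k) / real (k ^ 2 + k)"
proof -
  have K: "int (k ^ 2 + k) = int k * (int k + 1)"
    by (simp add: power2_eq_square algebra_simps)
  have "int ` {n \<in> {0..<k ^ 2 + k}. N (int n) k = 0} =
      {c \<in> {0..<int k * (int k + 1)}. links_connect (int k) c}" (is "?A = ?B")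
  proof (intro equalityI subsetI)
    fix c assume "c \<in> ?A"
    then obtain n where n: "c = int n" "n < k ^ 2 + k" "N (int n) k = 0" by auto
    from n(2) have "int n < int k * (int k + 1)" unfolding K[symmetric] by (simp only: of_nat_less_iff)
    with n show "c \<in> ?B" using N_eq_0_iff[OF assms n(2)] by simp
  next
    fix c assume c: "c \<in> ?B"
    then obtain n where n: "c = int n" by (auto dest: zero_le_imp_eq_int)
    with c have "int n < int (k ^ 2 + k)" unfolding K by simp
    then have "n < k ^ 2 + k" by (simp only: of_nat_less_iff)
    with n c show "c \<in> ?A" using N_eq_0_iff[OF assms, of n] by simp
  qed
  then have "card {n \<in> {0..<k ^ 2 + k}. N (int n) k = 0} = totient_sum k"
    using card_links_connect[of "int k"] card_farey_denominators[of k] assms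
      card_image[of int "{n \<in> {0..<k ^ 2 + k}. N (int n) k = 0}"]
    by (simp add: inj_on_def)
  then show ?thesis by (simp only: P0_def)
qed

theorem theorem8p1:
  shows "P0 \<longlonglongrightarrow> 3 / pi^2"
proof -
  have "(\<lambda>k. 1 / (1 + 1 / real k)) \<longlonglongrightarrow> 1 / (1 + 0)"
    by (intro tendsto_intros lim_1_over_n) auto
  then have "(\<lambda>k. real (totient_sum k) / real k ^ 2 * (1 / (1 + 1 / real k))) \<longlonglongrightarrow> 3 / pi ^ 2 * 1"
    by (intro tendsto_mult totient_sum_asymptotics) simp
  moreover have "\<forall>\<^sub>F k in sequentially.
      real (totient_sum k) / real k ^ 2 * (1 / (1 + 1 / real k)) = P0 k"
    using eventually_ge_at_top[of 1]
  proof eventually_elim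
    case (elim k)
    then have "real (k ^ 2 + k) = real k ^ 2 * (1 + 1 / real k)"
      by (simp add: field_simps power2_eq_square)
    then show ?case by (simp add: P0_eq_totient_sum[OF elim])
  qed
  ultimately show ?thesis by (simp add: filterlim_cong)
qed

end
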